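(* Let $X$ be a Banach space, $(\Theta,\mu)$ a complete measure space and $\mathcal X=L_1(\Theta,X)$ (Bochner space). Let $\{(T_m,D(T_m))\}_{m\in\Theta}$ be a family of operators in $X$ such that for almost every $m\in\Theta$ the operator $(T_m,D(T_m))$ generates a $C_0$-semigroup $(G_m(t))_{t\ge 0}$ on $X$ with $\|G_m(t)\|_{L(X)}\le M_me^{\omega_m t}$, $t\ge 0$, for some $M_m\ge 1$ and $\omega_m\in\mathbb R$. Assume that there are constants $M$ and $\omega$ such that $M_m\le M$ and $\omega_m\le\omega$ for all $m$ for which $M_m,\omega_m$ are defined. If the function $\Theta\ni m\mapsto R(\lambda,T_m)f(m)\in X$ is measurable for any $\lambda>\omega$ and any $f\in\mathcal X$, then the operator $\mathbf T$ on $\mathcal X$ defined by $$[\mathbf T u](m)=T_mu(m),\ m\in\Theta,\qquad D(\mathbf T)=\{u\in\mathcal X:\ u(m)\in D(T_m)\text{ for } m\in\Theta,\ \mathbf Tu\in\mathcal X\},$$ generates a $C_0$-semigroup $(\mathbf G(t))_{t\ge0}$ on $\mathcal X$ satisfying $$[\mathbf G(t)u](m)=G_m(t)u(m),\qquad u\in\mathcal X,\ m\in\Theta,\ t\ge 0,$$ and its resolvent is given by $$[R(\lambda,\mathbf T)f](m)=R(\lambda,T_m)f(m),\qquad m\in\Theta,\ f\in\mathcal X .$$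
   Context: $L(X)$ is the space of bounded linear operators on $X$, and $R(\lambda,T)=(\lambda I-T)^{-1}$. Pointwise properties "for $m\in\Theta$" are understood for almost every $m$. Measurability of $X$-valued functions is Bochner (strong) measurability. *)

theory Defs
  imports "HOL-Analysis.Analysis"
begin

section \<open>Normed spaces with explicit carrier\<close>

text \<open>
  The space \<open>L\<^sub>1(\<mu>, X)\<close> depends on the measure \<open>\<mu>\<close>, which is a term, so it cannot be a type.
  The notions of operator theory are therefore stated for normed spaces given by a carrier and
  operations; a type of class \<open>banach\<close> is the instance \<open>type_space\<close>.
\<close>

record 'v normed_structure =
  nspace :: "'v set"
  nadd :: "'v \<Rightarrow> 'v \<Rightarrow> 'v"
  nscale :: "real \<Rightarrow> 'v \<Rightarrow> 'v"
  nnorm :: "'v \<Rightarrow> real"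

definition ndiff :: "'v normed_structure \<Rightarrow> 'v \<Rightarrow> 'v \<Rightarrow> 'v" where
  "ndiff V x y = nadd V x (nscale V (- 1) y)"

definition type_space :: "'x::real_normed_vector normed_structure" where
  "type_space = \<lparr>nspace = UNIV, nadd = (+), nscale = scaleR, nnorm = norm\<rparr>"

definition bounded_operator :: "'v normed_structure \<Rightarrow> ('v \<Rightarrow> 'v) \<Rightarrow> bool" where
  "bounded_operator V B \<longleftrightarrow>
     (\<forall>x\<in>nspace V. B x \<in> nspace V) \<and>
     (\<forall>x\<in>nspace V. \<forall>y\<in>nspace V. B (nadd V x y) = nadd V (B x) (B y)) \<and>
     (\<forall>c. \<forall>x\<in>nspace V. B (nscale V c x) = nscale V c (B x)) \<and>
     (\<exists>K. \<forall>x\<in>nspace V. nnorm V (B x) \<le> K * nnorm V x)"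

definition norm_tendsto ::
  "'v normed_structure \<Rightarrow> ('a \<Rightarrow> 'v) \<Rightarrow> 'v \<Rightarrow> 'a filter \<Rightarrow> bool" where
  "norm_tendsto V f l F \<longleftrightarrow> ((\<lambda>t. nnorm V (ndiff V (f t) l)) \<longlongrightarrow> 0) F"

definition C0_semigroup :: "'v normed_structure \<Rightarrow> (real \<Rightarrow> 'v \<Rightarrow> 'v) \<Rightarrow> bool" where
  "C0_semigroup V G \<longleftrightarrow>
     (\<forall>t\<ge>0. bounded_operator V (G t)) \<and>
     (\<forall>x\<in>nspace V. G 0 x = x) \<and>
     (\<forall>s\<ge>0. \<forall>t\<ge>0. \<forall>x\<in>nspace V. G (s + t) x = G s (G t x)) \<and>
     (\<forall>x\<in>nspace V. norm_tendsto V (\<lambda>t. G t x) x (at_right 0))"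

definition has_right_derivative_at_0 ::
  "'v normed_structure \<Rightarrow> (real \<Rightarrow> 'v \<Rightarrow> 'v) \<Rightarrow> 'v \<Rightarrow> 'v \<Rightarrow> bool" where
  "has_right_derivative_at_0 V G x y \<longleftrightarrow>
     norm_tendsto V (\<lambda>h. nscale V (1 / h) (ndiff V (G h x) x)) y (at_right 0)"

text \<open>
  An operator \<open>(A, D(A))\<close> in a space is given by a set \<open>D\<close> and a function \<open>A\<close> whose values
  outside \<open>D\<close> are irrelevant.
\<close>

definition generates ::
  "'v normed_structure \<Rightarrow> 'v set \<Rightarrow> ('v \<Rightarrow> 'v) \<Rightarrow> (real \<Rightarrow> 'v \<Rightarrow> 'v) \<Rightarrow> bool" where
  "generates V D A G \<longleftrightarrow>
     C0_semigroup V G \<and>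
     D = {x \<in> nspace V. \<exists>y\<in>nspace V. has_right_derivative_at_0 V G x y} \<and>
     (\<forall>x\<in>D. A x \<in> nspace V \<and> has_right_derivative_at_0 V G x (A x))"

text \<open>
  \<open>resolvent V D A l\<close> is \<open>(l I - A)\<^sup>-\<^sup>1\<close>; it is meaningful for \<open>l \<in> resolvent_set V D A\<close>.
\<close>

definition resolvent ::
  "'v normed_structure \<Rightarrow> 'v set \<Rightarrow> ('v \<Rightarrow> 'v) \<Rightarrow> real \<Rightarrow> 'v \<Rightarrow> 'v" where
  "resolvent V D A l = inv_into D (\<lambda>x. ndiff V (nscale V l x) (A x))"

definition resolvent_set :: "'v normed_structure \<Rightarrow> 'v set \<Rightarrow> ('v \<Rightarrow> 'v) \<Rightarrow> real set" where
  "resolvent_set V D A =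
     {l. bij_betw (\<lambda>x. ndiff V (nscale V l x) (A x)) D (nspace V) \<and>
         bounded_operator V (resolvent V D A l)}"

lemma type_space_simps [simp]:
  "nspace type_space = UNIV" "nadd type_space = (+)" "nscale type_space = scaleR"
  "nnorm type_space = norm" "ndiff type_space x y = x - y"
  by (simp_all add: type_space_def ndiff_def)

lemma norm_tendsto_type_space [simp]: "norm_tendsto type_space f l F \<longleftrightarrow> (f \<longlongrightarrow> l) F"
  by (simp add: norm_tendsto_def tendsto_norm_zero_iff LIM_zero_iff)

lemma bounded_operator_type_space [simp]: "bounded_operator type_space B \<longleftrightarrow> bounded_linear B"
proof
  assume "bounded_operator type_space B"
  then obtain K where "\<And>x. norm (B x) \<le> K * norm x"
    and "\<And>x y. B (x + y) = B x + B y" "\<And>c x. B (c *\<^sub>R x) = c *\<^sub>R B x"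
    unfolding bounded_operator_def by auto
  then show "bounded_linear B"
    by (intro bounded_linear_intro[where K = K]) (simp_all add: mult.commute)
next
  assume "bounded_linear B"
  then interpret bounded_linear B .
  obtain K where "\<And>x. norm (B x) \<le> norm x * K" using bounded by blast
  then have "\<exists>K. \<forall>x. norm (B x) \<le> K * norm x" by (auto simp: mult.commute)
  then show "bounded_operator type_space B" by (simp add: bounded_operator_def add scaleR)
qed


section \<open>Strong measurability and the Bochner space\<close>

text \<open>
  The library's Bochner integral requires a second countable range, which would restrict \<open>X\<close> to
  separable spaces.  Elements of \<open>L1 \<mu>\<close> are the a.e.-equality classes.
\<close>

definition strongly_measurable :: "'m measure \<Rightarrow> ('m \<Rightarrow> 'x::real_normed_vector) \<Rightarrow> bool" where
  "strongly_measurable \<mu> f \<longleftrightarrow>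
     (\<exists>s. (\<forall>i. simple_function \<mu> (s i)) \<and> (AE m in \<mu>. (\<lambda>i. s i m) \<longlonglongrightarrow> f m))"

definition bochner_integrable :: "'m measure \<Rightarrow> ('m \<Rightarrow> 'x::real_normed_vector) \<Rightarrow> bool" where
  "bochner_integrable \<mu> f \<longleftrightarrow> strongly_measurable \<mu> f \<and> integrable \<mu> (\<lambda>m. norm (f m))"

definition ae_eq :: "'m measure \<Rightarrow> (('m \<Rightarrow> 'x::real_normed_vector) \<times> ('m \<Rightarrow> 'x)) set" where
  "ae_eq \<mu> = {(f, g). bochner_integrable \<mu> f \<and> bochner_integrable \<mu> g \<and> (AE m in \<mu>. f m = g m)}"

definition L1 :: "'m measure \<Rightarrow> ('m \<Rightarrow> 'x::real_normed_vector) set normed_structure" where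
  "L1 \<mu> = \<lparr>nspace = {f. bochner_integrable \<mu> f} // ae_eq \<mu>,
           nadd = (\<lambda>U V. \<Union>u\<in>U. \<Union>v\<in>V. ae_eq \<mu> `` {\<lambda>m. u m + v m}),
           nscale = (\<lambda>c U. \<Union>u\<in>U. ae_eq \<mu> `` {\<lambda>m. c *\<^sub>R u m}),
           nnorm = (\<lambda>U. the_elem ((\<lambda>u. \<integral>m. norm (u m) \<partial>\<mu>) ` U))\<rparr>"


section \<open>The operator acting fibrewise\<close>

text \<open>
  The values of \<open>T m\<close> outside \<open>D m\<close> do not matter: they enter only on a null set of \<open>m\<close>.  That the
  choice of the representative is irrelevant is shown in \<open>fibre_domain_iff\<close> and \<open>fibre_op_class\<close>.
\<close>

definition fibre_domain ::
  "'m measure \<Rightarrow> ('m \<Rightarrow> 'x set) \<Rightarrow> ('m \<Rightarrow> 'x \<Rightarrow> 'x::real_normed_vector) \<Rightarrow> ('m \<Rightarrow> 'x) set set" where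
  "fibre_domain \<mu> D T =
     {U \<in> nspace (L1 \<mu>). \<exists>u\<in>U. (AE m in \<mu>. u m \<in> D m) \<and> bochner_integrable \<mu> (\<lambda>m. T m (u m))}"

definition fibre_op ::
  "'m measure \<Rightarrow> ('m \<Rightarrow> 'x \<Rightarrow> 'x::real_normed_vector) \<Rightarrow> ('m \<Rightarrow> 'x) set \<Rightarrow> ('m \<Rightarrow> 'x) set" where
  "fibre_op \<mu> T U = (\<Union>u\<in>U. ae_eq \<mu> `` {\<lambda>m. T m (u m)})"


section \<open>Independence of representatives\<close>

lemma borel_measurable_cong_AE_complete:
  fixes f g :: "'m \<Rightarrow> real"
  assumes "complete_measure \<mu>" "f \<in> borel_measurable \<mu>" "AE m in \<mu>. f m = g m"
  shows "g \<in> borel_measurable \<mu>"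
proof (rule measurableI)
  interpret complete_measure \<mu> by fact
  fix A :: "real set" assume A: "A \<in> sets borel"
  have 1: "f -` A \<inter> space \<mu> \<in> sets \<mu>" using assms(2) A by (rule measurable_sets)
  have 2: "AE m in \<mu>. m \<in> f -` A \<inter> space \<mu> \<longleftrightarrow> m \<in> g -` A \<inter> space \<mu>"
    using assms(3) by eventually_elim auto
  show "g -` A \<inter> space \<mu> \<in> sets \<mu>" by (rule in_sets_AE[OF 2 1]) simp
qed simp

lemma strongly_measurable_norm:
  assumes "complete_measure \<mu>" "strongly_measurable \<mu> f"
  shows "(\<lambda>m. norm (f m)) \<in> borel_measurable \<mu>"
proof -
  from assms(2) obtain s where s: "\<And>i. simple_function \<mu> (s i)"
    and lim: "AE m in \<mu>. (\<lambda>i. s i m) \<longlonglongrightarrow> f m"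
    unfolding strongly_measurable_def by blast
  have "(\<lambda>m. lim (\<lambda>i. norm (s i m))) \<in> borel_measurable \<mu>"
    by (rule borel_measurable_lim_metric)
      (rule borel_measurable_simple_function[OF simple_function_compose1[OF s]])
  moreover have "AE m in \<mu>. lim (\<lambda>i. norm (s i m)) = norm (f m)"
    using lim by eventually_elim (intro limI tendsto_norm)
  ultimately show ?thesis by (rule borel_measurable_cong_AE_complete[OF assms(1)])
qed

lemma strongly_measurable_cong_AE:
  assumes "strongly_measurable \<mu> f" "AE m in \<mu>. f m = g m"
  shows "strongly_measurable \<mu> g"
proof -
  from assms(1) obtain s where s: "\<And>i. simple_function \<mu> (s i)"
    and lim: "AE m in \<mu>. (\<lambda>i. s i m) \<longlonglongrightarrow> f m"
    unfolding strongly_measurable_def by blast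
  have "AE m in \<mu>. (\<lambda>i. s i m) \<longlonglongrightarrow> g m" using lim assms(2) by eventually_elim simp
  then show ?thesis using s unfolding strongly_measurable_def by blast
qed

lemma bochner_integrable_bound:
  assumes "complete_measure \<mu>" "strongly_measurable \<mu> f" "integrable \<mu> h"
    and "AE m in \<mu>. norm (f m) \<le> h m"
  shows "bochner_integrable \<mu> f"
  unfolding bochner_integrable_def
proof (intro conjI assms(2))
  have "AE m in \<mu>. norm (norm (f m)) \<le> norm (h m)" using assms(4) by eventually_elim auto
  then show "integrable \<mu> (\<lambda>m. norm (f m))"
    by (rule Bochner_Integration.integrable_bound[OF assms(3) strongly_measurable_norm[OF assms(1,2)]])
qed

lemma bochner_integrable_cong_AE:
  assumes "complete_measure \<mu>" "bochner_integrable \<mu> f" "AE m in \<mu>. f m = g m"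
  shows "bochner_integrable \<mu> g"
proof (rule bochner_integrable_bound[OF assms(1)])
  show "strongly_measurable \<mu> g"
    using assms(2,3) unfolding bochner_integrable_def by (blast intro: strongly_measurable_cong_AE)
  show "integrable \<mu> (\<lambda>m. norm (f m))" using assms(2) unfolding bochner_integrable_def by blast
  show "AE m in \<mu>. norm (g m) \<le> norm (f m)" using assms(3) by eventually_elim simp
qed

lemma bochner_integrable_zero: "bochner_integrable \<mu> (\<lambda>m. 0)"
  unfolding bochner_integrable_def strongly_measurable_def
  by (intro conjI exI[of _ "\<lambda>i m. 0"]) simp_all

lemma bochner_integrable_add:
  assumes c: "complete_measure \<mu>" and f: "bochner_integrable \<mu> f" and g: "bochner_integrable \<mu> g"
  shows "bochner_integrable \<mu> (\<lambda>m. f m + g m)"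
proof (rule bochner_integrable_bound[OF c])
  obtain s where s: "\<And>i. simple_function \<mu> (s i)" "AE m in \<mu>. (\<lambda>i. s i m) \<longlonglongrightarrow> f m"
    using f unfolding bochner_integrable_def strongly_measurable_def by blast
  obtain r where r: "\<And>i. simple_function \<mu> (r i)" "AE m in \<mu>. (\<lambda>i. r i m) \<longlonglongrightarrow> g m"
    using g unfolding bochner_integrable_def strongly_measurable_def by blast
  show "strongly_measurable \<mu> (\<lambda>m. f m + g m)"
    unfolding strongly_measurable_def
  proof (intro exI conjI allI)
    show "simple_function \<mu> (\<lambda>m. s i m + r i m)" for i
      by (rule simple_function_compose2[OF s(1) r(1)])
    show "AE m in \<mu>. (\<lambda>i. s i m + r i m) \<longlonglongrightarrow> f m + g m"
      using s(2) r(2) by eventually_elim (rule tendsto_add)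
  qed
  show "integrable \<mu> (\<lambda>m. norm (f m) + norm (g m))"
    using f g unfolding bochner_integrable_def by simp
  show "AE m in \<mu>. norm (f m + g m) \<le> norm (f m) + norm (g m)"
    by (simp add: norm_triangle_ineq)
qed

lemma bochner_integrable_scaleR:
  assumes c: "complete_measure \<mu>" and f: "bochner_integrable \<mu> f"
  shows "bochner_integrable \<mu> (\<lambda>m. c *\<^sub>R f m)"
proof (rule bochner_integrable_bound[OF c])
  obtain s where s: "\<And>i. simple_function \<mu> (s i)" "AE m in \<mu>. (\<lambda>i. s i m) \<longlonglongrightarrow> f m"
    using f unfolding bochner_integrable_def strongly_measurable_def by blast
  show "strongly_measurable \<mu> (\<lambda>m. c *\<^sub>R f m)"
    unfolding strongly_measurable_def
  proof (intro exI conjI allI)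
    show "simple_function \<mu> (\<lambda>m. c *\<^sub>R s i m)" for i
      by (rule simple_function_compose1[OF s(1)])
    show "AE m in \<mu>. (\<lambda>i. c *\<^sub>R s i m) \<longlonglongrightarrow> c *\<^sub>R f m"
      using s(2) by eventually_elim (rule tendsto_scaleR[OF tendsto_const])
  qed
  show "integrable \<mu> (\<lambda>m. \<bar>c\<bar> * norm (f m))"
    using f unfolding bochner_integrable_def by simp
qed simp

lemma equiv_ae_eq: "equiv {f. bochner_integrable \<mu> f} (ae_eq \<mu>)"
proof (rule equivI)
  show "ae_eq \<mu> \<subseteq> {f. bochner_integrable \<mu> f} \<times> {f. bochner_integrable \<mu> f}"
    by (auto simp: ae_eq_def)
  show "refl_on {f. bochner_integrable \<mu> f} (ae_eq \<mu>)" by (auto simp: refl_on_def ae_eq_def)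
  show "sym (ae_eq \<mu>)" by (auto simp: sym_def ae_eq_def)
  show "trans (ae_eq \<mu>)" proof (rule transI)
    fix f g h assume *: "(f, g) \<in> ae_eq \<mu>" "(g, h) \<in> ae_eq \<mu>"
    then have "AE m in \<mu>. f m = g m" "AE m in \<mu>. g m = h m" by (auto simp: ae_eq_def)
    then have "AE m in \<mu>. f m = h m" by eventually_elim simp
    with * show "(f, h) \<in> ae_eq \<mu>" by (auto simp: ae_eq_def)
  qed
qed

lemma L1_cases:
  assumes "U \<in> nspace (L1 \<mu>)"
  obtains u where "bochner_integrable \<mu> u" "U = ae_eq \<mu> `` {u}"
  using assms by (auto simp: L1_def elim: quotientE)

lemma ae_class_in_L1: "bochner_integrable \<mu> u \<Longrightarrow> ae_eq \<mu> `` {u} \<in> nspace (L1 \<mu>)"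
  by (auto simp: L1_def intro: quotientI)

lemma ae_class_eq_iff:
  assumes "bochner_integrable \<mu> u" "bochner_integrable \<mu> v"
  shows "ae_eq \<mu> `` {u} = ae_eq \<mu> `` {v} \<longleftrightarrow> (AE m in \<mu>. u m = v m)"
  using assms eq_equiv_class_iff[OF equiv_ae_eq, of u \<mu> v] by (simp add: ae_eq_def)

lemma L1_add:
  fixes u v :: "'m \<Rightarrow> 'x::real_normed_vector"
  assumes c: "complete_measure \<mu>" and u: "bochner_integrable \<mu> u" and v: "bochner_integrable \<mu> v"
  shows "nadd (L1 \<mu>) (ae_eq \<mu> `` {u}) (ae_eq \<mu> `` {v}) = ae_eq \<mu> `` {\<lambda>m. u m + v m}"
proof -
  have "congruent2 (ae_eq \<mu>) (ae_eq \<mu>) (\<lambda>(u :: 'm \<Rightarrow> 'x) (v :: 'm \<Rightarrow> 'x). ae_eq \<mu> `` {\<lambda>m. u m + v m})"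
  proof (rule congruent2I')
    fix u u' v v' :: "'m \<Rightarrow> 'x" assume "(u, u') \<in> ae_eq \<mu>" "(v, v') \<in> ae_eq \<mu>"
    then have *: "bochner_integrable \<mu> u" "bochner_integrable \<mu> u'" "bochner_integrable \<mu> v"
      "bochner_integrable \<mu> v'" and ae: "AE m in \<mu>. u m = u' m" "AE m in \<mu>. v m = v' m"
      by (auto simp: ae_eq_def)
    have "AE m in \<mu>. u m + v m = u' m + v' m" using ae by eventually_elim simp
    then show "ae_eq \<mu> `` {\<lambda>m. u m + v m} = ae_eq \<mu> `` {\<lambda>m. u' m + v' m}"
      using * by (subst ae_class_eq_iff) (auto intro: bochner_integrable_add[OF c])
  qed
  from UN_equiv_class2[OF equiv_ae_eq equiv_ae_eq this] u v show ?thesis by (simp add: L1_def)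
qed

lemma L1_scale:
  fixes u :: "'m \<Rightarrow> 'x::real_normed_vector"
  assumes c: "complete_measure \<mu>" and u: "bochner_integrable \<mu> u"
  shows "nscale (L1 \<mu>) a (ae_eq \<mu> `` {u}) = ae_eq \<mu> `` {\<lambda>m. a *\<^sub>R u m}"
proof -
  have "(\<lambda>u :: 'm \<Rightarrow> 'x. ae_eq \<mu> `` {\<lambda>m. a *\<^sub>R u m}) respects (ae_eq \<mu>)"
  proof (rule congruentI)
    fix u u' :: "'m \<Rightarrow> 'x" assume "(u, u') \<in> ae_eq \<mu>"
    then have *: "bochner_integrable \<mu> u" "bochner_integrable \<mu> u'"
      and ae: "AE m in \<mu>. u m = u' m"
      by (auto simp: ae_eq_def)
    have "AE m in \<mu>. a *\<^sub>R u m = a *\<^sub>R u' m" using ae by eventually_elim simp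
    then show "ae_eq \<mu> `` {\<lambda>m. a *\<^sub>R u m} = ae_eq \<mu> `` {\<lambda>m. a *\<^sub>R u' m}"
      using * by (subst ae_class_eq_iff) (auto intro: bochner_integrable_scaleR[OF c])
  qed
  from UN_equiv_class[OF equiv_ae_eq this] u show ?thesis by (simp add: L1_def)
qed

lemma L1_norm:
  assumes u: "bochner_integrable \<mu> u"
  shows "nnorm (L1 \<mu>) (ae_eq \<mu> `` {u}) = (\<integral>m. norm (u m) \<partial>\<mu>)"
proof -
  have *: "(\<integral>m. norm (v m) \<partial>\<mu>) = (\<integral>m. norm (u m) \<partial>\<mu>)" if "v \<in> ae_eq \<mu> `` {u}" for v
  proof (rule integral_cong_AE)
    show "(\<lambda>m. norm (v m)) \<in> borel_measurable \<mu>" "(\<lambda>m. norm (u m)) \<in> borel_measurable \<mu>"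
      using that u by (auto simp: ae_eq_def bochner_integrable_def)
    have "AE m in \<mu>. u m = v m" using that by (simp add: ae_eq_def)
    then show "AE m in \<mu>. norm (v m) = norm (u m)" by eventually_elim simp
  qed
  have "u \<in> ae_eq \<mu> `` {u}" using u by (simp add: ae_eq_def)
  have "(\<lambda>v. \<integral>m. norm (v m) \<partial>\<mu>) ` (ae_eq \<mu> `` {u}) = (\<lambda>_. \<integral>m. norm (u m) \<partial>\<mu>) ` (ae_eq \<mu> `` {u})"
    by (rule image_cong[OF refl *])
  also have "\<dots> = {\<integral>m. norm (u m) \<partial>\<mu>}" by (rule image_constant) fact
  finally show ?thesis by (simp add: L1_def)
qed

lemma fibre_domain_iff:
  assumes c: "complete_measure \<mu>" and u: "bochner_integrable \<mu> u"
  shows "ae_eq \<mu> `` {u} \<in> fibre_domain \<mu> D T \<longleftrightarrow>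
           (AE m in \<mu>. u m \<in> D m) \<and> bochner_integrable \<mu> (\<lambda>m. T m (u m))" (is "?L \<longleftrightarrow> ?R")
proof
  assume ?L
  then obtain v where v: "AE m in \<mu>. u m = v m" "AE m in \<mu>. v m \<in> D m"
    "bochner_integrable \<mu> (\<lambda>m. T m (v m))"
    by (auto simp: fibre_domain_def ae_eq_def)
  have "AE m in \<mu>. u m \<in> D m" using v(1,2) by eventually_elim simp
  moreover have "AE m in \<mu>. T m (v m) = T m (u m)" using v(1) by eventually_elim simp
  ultimately show ?R using bochner_integrable_cong_AE[OF c v(3), of "\<lambda>m. T m (u m)"] by simp
next
  assume ?R
  moreover have "u \<in> ae_eq \<mu> `` {u}" using u by (simp add: ae_eq_def)
  ultimately show ?L using ae_class_in_L1[OF u] unfolding fibre_domain_def by blast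
qed

lemma fibre_op_class:
  assumes c: "complete_measure \<mu>" and u: "bochner_integrable \<mu> u"
    and Tu: "bochner_integrable \<mu> (\<lambda>m. T m (u m))"
  shows "fibre_op \<mu> T (ae_eq \<mu> `` {u}) = ae_eq \<mu> `` {\<lambda>m. T m (u m)}"
proof -
  have "ae_eq \<mu> `` {\<lambda>m. T m (v m)} = ae_eq \<mu> `` {\<lambda>m. T m (u m)}" if "v \<in> ae_eq \<mu> `` {u}" for v
  proof -
    have "AE m in \<mu>. u m = v m" using that by (simp add: ae_eq_def)
    then have ae: "AE m in \<mu>. T m (u m) = T m (v m)" by eventually_elim simp
    have "bochner_integrable \<mu> (\<lambda>m. T m (v m))" by (rule bochner_integrable_cong_AE[OF c Tu ae])
    moreover from ae have "AE m in \<mu>. T m (v m) = T m (u m)" by eventually_elim simp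
    ultimately show ?thesis using ae_class_eq_iff[OF _ Tu, of "\<lambda>m. T m (v m)"] by simp
  qed
  then have "fibre_op \<mu> T (ae_eq \<mu> `` {u}) =
      (\<Union>v\<in>ae_eq \<mu> `` {u}. ae_eq \<mu> `` {\<lambda>m. T m (u m)})"
    unfolding fibre_op_def by (intro SUP_cong refl)
  also have "\<dots> = ae_eq \<mu> `` {\<lambda>m. T m (u m)}"
  proof (rule UN_constant_eq)
    show "u \<in> ae_eq \<mu> `` {u}" using u by (simp add: ae_eq_def)
  qed simp
  finally show ?thesis .
qed

end

theory Submission
  imports Defs
begin

text \<open>
  The candidate semigroup acts fibrewise.  It is well defined because, by the exponential formula,
  \<open>G\<^sub>m(t)f(m)\<close> is the limit of \<open>[(n/t) R(n/t, T\<^sub>m)]\<^sup>n f(m)\<close>, and each iterate is strongly measurable by the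
  assumption on the resolvents.  Dominated convergence gives strong continuity, and, using
  \<open>\<parallel>G\<^sub>m(h)x - x\<parallel> \<le> h C \<parallel>T\<^sub>m x\<parallel>\<close>, that the generator extends \<open>\<^bold>T\<close>.  Conversely, \<open>L\<^sub>1\<close>-convergent
  difference quotients converge almost everywhere along a sequence, which puts \<open>u(m)\<close> into \<open>D(T\<^sub>m)\<close>.
  For a single semigroup, \<open>l - T\<^sub>m\<close> is inverted without improper integrals: with
  \<open>z = \<integral>\<^sub>0\<^sup>N e\<^sup>-\<^sup>l\<^sup>s G(s)x ds\<close> one has \<open>(l - T\<^sub>m)z = x - e\<^sup>-\<^sup>l\<^sup>N G(N)x\<close>, and for large \<open>N\<close> the right-hand
  side runs through the whole space by the contraction principle.
\<close>

section \<open>Semigroups on a Banach space\<close>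

text \<open>The one-sided fundamental theorem of calculus. The case \<open>c = a\<close> is allowed,
  so the same fact differentiates integrals at both end points of an orbit segment.\<close>

lemma tendsto_difference_quotient_integral:
  fixes f :: "real \<Rightarrow> 'a::banach"
  assumes "continuous_on {a..b} f" "a \<le> c" "c < b"
  shows "((\<lambda>h. (1 / h) *\<^sub>R (integral {a..c + h} f - integral {a..c} f)) \<longlongrightarrow> f c) (at_right 0)"
proof (rule tendstoI)
  fix e :: real assume "e > 0"
  have "((\<lambda>u. integral {a..u} f) has_vector_derivative f c) (at c within {a..b})"
    using assms by (intro integral_has_vector_derivative) auto
  then obtain d where "d > 0"
    and d: "\<And>y. y \<in> {a..b} \<Longrightarrow> \<bar>y - c\<bar> < d \<Longrightarrow>
      norm (integral {a..y} f - integral {a..c} f - (y - c) *\<^sub>R f c) \<le> e / 2 * \<bar>y - c\<bar>"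
    unfolding has_vector_derivative_def has_derivative_within_alt using \<open>e > 0\<close>
    by (metis half_gt_zero real_norm_def)
  have "dist ((1 / h) *\<^sub>R (integral {a..c + h} f - integral {a..c} f)) (f c) < e"
    if h: "0 < h" "h < min d (b - c)" for h
  proof -
    have "(1 / h) *\<^sub>R (integral {a..c + h} f - integral {a..c} f) - f c =
        (1 / h) *\<^sub>R (integral {a..c + h} f - integral {a..c} f - h *\<^sub>R f c)"
      using h by (simp add: scaleR_diff_right)
    moreover have "norm (integral {a..c + h} f - integral {a..c} f - h *\<^sub>R f c) \<le> e / 2 * h"
      using d[of "c + h"] h assms by auto
    ultimately have "dist ((1 / h) *\<^sub>R (integral {a..c + h} f - integral {a..c} f)) (f c) \<le> e / 2"
      using h by (simp add: dist_norm pos_divide_le_eq)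
    then show ?thesis using \<open>e > 0\<close> by simp
  qed
  then show "\<forall>\<^sub>F h in at_right 0.
      dist ((1 / h) *\<^sub>R (integral {a..c + h} f - integral {a..c} f)) (f c) < e"
    unfolding eventually_at_right_field using \<open>d > 0\<close> \<open>c < b\<close>
    by (intro exI[of _ "min d (b - c)"]) auto
qed

locale exp_bounded_semigroup =
  fixes D :: "'x::banach set" and A :: "'x \<Rightarrow> 'x" and G :: "real \<Rightarrow> 'x \<Rightarrow> 'x" and M \<omega> :: real
  assumes generates: "generates type_space D A G"
    and M_ge_1: "1 \<le> M"
    and growth: "0 \<le> t \<Longrightarrow> norm (G t x) \<le> M * exp (\<omega> * t) * norm x"
begin

section \<open>Orbits of one semigroup and elementary rules for its generator\<close>

lemma bounded_linear_G: "0 \<le> t \<Longrightarrow> bounded_linear (G t)"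
  and G_0 [simp]: "G 0 x = x"
  and G_add: "0 \<le> s \<Longrightarrow> 0 \<le> t \<Longrightarrow> G (s + t) x = G s (G t x)"
  and tendsto_G_0: "((\<lambda>t. G t x) \<longlongrightarrow> x) (at_right 0)"
  using generates by (auto simp: generates_def C0_semigroup_def)

lemma generator_tendsto: "x \<in> D \<Longrightarrow> ((\<lambda>h. (1 / h) *\<^sub>R (G h x - x)) \<longlongrightarrow> A x) (at_right 0)"
  using generates by (simp add: generates_def has_right_derivative_at_0_def)

lemma generatorI:
  assumes "((\<lambda>h. (1 / h) *\<^sub>R (G h x - x)) \<longlongrightarrow> y) (at_right 0)"
  shows "x \<in> D" "A x = y"
proof -
  show "x \<in> D" using generates assms by (auto simp: generates_def has_right_derivative_at_0_def)
  from tendsto_unique[OF _ generator_tendsto[OF this] assms] show "A x = y" by simp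
qed

text \<open>Replacing \<open>\<omega>\<close> by its absolute value makes the bound increasing in
  time, so that one constant serves the whole interval from 0 to \<open>\<tau>\<close> whatever the
  sign of \<open>\<omega>\<close>.\<close>

lemma growth_le:
  assumes "0 \<le> t" "t \<le> \<tau>"
  shows "norm (G t x) \<le> M * exp (\<bar>\<omega>\<bar> * \<tau>) * norm x"
proof -
  have "\<omega> * t \<le> \<bar>\<omega>\<bar> * \<tau>" using assms by (intro mult_mono) auto
  then have "M * exp (\<omega> * t) * norm x \<le> M * exp (\<bar>\<omega>\<bar> * \<tau>) * norm x"
    using M_ge_1 by (intro mult_right_mono mult_left_mono) auto
  with growth[OF assms(1), of x] show ?thesis by linarith
qed

lemma norm_G_diff_le:
  assumes "0 \<le> a" "a \<le> b" "b \<le> \<tau>"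
  shows "norm (G b x - G a x) \<le> M * exp (\<bar>\<omega>\<bar> * \<tau>) * norm (G (b - a) x - x)"
proof -
  interpret bounded_linear "G a" by (rule bounded_linear_G) fact
  have "G b x - G a x = G a (G (b - a) x - x)"
    using G_add[of a "b - a" x] assms by (simp add: diff)
  then show ?thesis using growth_le[of a \<tau> "G (b - a) x - x"] assms by simp
qed

lemma continuous_on_G: "continuous_on {0..} (\<lambda>t. G t x)"
  unfolding continuous_on_iff
proof (intro ballI allI impI)
  fix t e :: real assume t: "t \<in> {0..}" and "0 < e"
  define K where "K = M * exp (\<bar>\<omega>\<bar> * (t + 1))"
  have "K > 0" using M_ge_1 by (simp add: K_def)
  have "\<forall>\<^sub>F h in at_right 0. dist (G h x) x < e / K"
    using tendsto_G_0[of x] \<open>e > 0\<close> \<open>K > 0\<close> by (intro tendstoD) auto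
  then obtain d where "d > 0" and d: "\<And>h. 0 < h \<Longrightarrow> h < d \<Longrightarrow> norm (G h x - x) < e / K"
    by (auto simp: eventually_at_right_field dist_norm)
  \<comment> \<open>One estimate for ordered times gives continuity from both sides: in either order
    the smaller time is factored out, and only right continuity at 0 enters. Restricting to times up
    to \<open>t + 1\<close> keeps \<open>K\<close> uniform, hence the radius
    \<open>min d 1\<close>.\<close>
  have *: "norm (G b x - G a x) < e" if "0 \<le> a" "a \<le> b" "b \<le> t + 1" "b - a < d" for a b
  proof (cases "a = b")
    case False
    have "norm (G b x - G a x) \<le> K * norm (G (b - a) x - x)"
      using norm_G_diff_le that unfolding K_def by blast
    also have "\<dots> < K * (e / K)"
      using d[of "b - a"] that False \<open>K > 0\<close> by (intro mult_strict_left_mono) auto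
    finally show ?thesis using \<open>K > 0\<close> by simp
  qed (use \<open>e > 0\<close> in simp)
  have "dist (G s x) (G t x) < e" if "s \<in> {0..}" "dist s t < min d 1" for s
    using that t *[of s t] *[of t s] by (cases "s \<le> t") (auto simp: dist_norm norm_minus_commute)
  then show "\<exists>d>0. \<forall>s\<in>{0..}. dist s t < d \<longrightarrow> dist (G s x) (G t x) < e"
    using \<open>d > 0\<close> by (intro exI[of _ "min d 1"]) auto
qed

lemma D_scaleR: "x \<in> D \<Longrightarrow> c *\<^sub>R x \<in> D" and A_scaleR: "x \<in> D \<Longrightarrow> A (c *\<^sub>R x) = c *\<^sub>R A x"
proof -
  assume x: "x \<in> D"
  have "\<forall>\<^sub>F h in at_right 0. c *\<^sub>R ((1 / h) *\<^sub>R (G h x - x)) = (1 / h) *\<^sub>R (G h (c *\<^sub>R x) - c *\<^sub>R x)"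
    using eventually_at_right_less
  proof eventually_elim
    case (elim h)
    then interpret bounded_linear "G h" by (intro bounded_linear_G) simp
    show ?case by (simp add: scaleR scaleR_diff_right)
  qed
  from Lim_transform_eventually[OF tendsto_scaleR[OF tendsto_const generator_tendsto[OF x]] this]
  show "c *\<^sub>R x \<in> D" "A (c *\<^sub>R x) = c *\<^sub>R A x" by (rule generatorI)+
qed

lemma D_add: "x \<in> D \<Longrightarrow> y \<in> D \<Longrightarrow> x + y \<in> D"
  and A_add: "x \<in> D \<Longrightarrow> y \<in> D \<Longrightarrow> A (x + y) = A x + A y"
proof -
  assume x: "x \<in> D" and y: "y \<in> D"
  have "\<forall>\<^sub>F h in at_right 0. (1 / h) *\<^sub>R (G h x - x) + (1 / h) *\<^sub>R (G h y - y) =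
      (1 / h) *\<^sub>R (G h (x + y) - (x + y))"
    using eventually_at_right_less
  proof eventually_elim
    case (elim h)
    then interpret bounded_linear "G h" by (intro bounded_linear_G) simp
    show ?case by (simp add: add algebra_simps)
  qed
  from Lim_transform_eventually[OF tendsto_add[OF generator_tendsto[OF x] generator_tendsto[OF y]] this]
  show "x + y \<in> D" "A (x + y) = A x + A y" by (rule generatorI)+
qed

lemma D_diff: "x \<in> D \<Longrightarrow> y \<in> D \<Longrightarrow> x - y \<in> D"
  and A_diff: "x \<in> D \<Longrightarrow> y \<in> D \<Longrightarrow> A (x - y) = A x - A y"
  using D_add[OF _ D_scaleR[of y "- 1"]] A_add[OF _ D_scaleR[of y "- 1"]] A_scaleR[of y "- 1"]
  by auto

lemma D_G: "x \<in> D \<Longrightarrow> 0 \<le> t \<Longrightarrow> G t x \<in> D"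
  and A_G: "x \<in> D \<Longrightarrow> 0 \<le> t \<Longrightarrow> A (G t x) = G t (A x)"
proof -
  assume x: "x \<in> D" and t: "0 \<le> t"
  interpret bounded_linear "G t" using t by (rule bounded_linear_G)
  have "\<forall>\<^sub>F h in at_right 0. G t ((1 / h) *\<^sub>R (G h x - x)) = (1 / h) *\<^sub>R (G h (G t x) - G t x)"
    using eventually_at_right_less
  proof eventually_elim
    case (elim h)
    then have "G h (G t x) = G t (G h x)"
      using G_add[of h t x] G_add[of t h x] t by (simp add: add.commute)
    then show ?case by (simp add: scaleR diff)
  qed
  from Lim_transform_eventually[OF tendsto[OF generator_tendsto[OF x]] this]
  show "G t x \<in> D" "A (G t x) = G t (A x)" by (rule generatorI)+
qed

text \<open>Applying exp(-l h) G(h) under the integral shifts the integrand by h. The difference to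
  the unshifted integral then consists of two short end pieces, whose quotients by h tend to the
  integrand at \<open>N\<close> and at 0.\<close>

lemma
  fixes l N :: real
  assumes "0 \<le> N"
  defines "z \<equiv> \<lambda>x. integral {0..N} (\<lambda>s. exp (- l * s) *\<^sub>R G s x)"
  shows integral_orbit_in_D: "z x \<in> D"
    and A_integral_orbit: "A (z x) = l *\<^sub>R z x - (x - exp (- l * N) *\<^sub>R G N x)"
proof -
  define P where "P = (\<lambda>s. exp (- l * s) *\<^sub>R G s x)"
  have cont: "continuous_on {a..b} P" if "0 \<le> a" for a b
    unfolding P_def using that
    by (intro continuous_intros continuous_on_subset[OF continuous_on_G]) auto
  have z: "z x = integral {0..N} P" by (simp add: z_def P_def)
  have shift: "exp (- l * h) *\<^sub>R G h (z x) =
      integral {0..N + h} P - integral {0..h} P" if h: "0 \<le> h" for h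
  proof -
    interpret bounded_linear "G h" using h by (rule bounded_linear_G)
    have "bounded_linear (\<lambda>y. exp (- l * h) *\<^sub>R G h y)"
      using bounded_linear_G[OF h] by (rule bounded_linear_const_scaleR)
    then have "exp (- l * h) *\<^sub>R G h (z x) = integral {0..N} ((\<lambda>y. exp (- l * h) *\<^sub>R G h y) \<circ> P)"
      unfolding z by (intro integral_linear[symmetric] integrable_continuous_real cont) simp_all
    also have "\<dots> = integral {0..N} (P \<circ> (\<lambda>s. s + h))"
    proof (rule Henstock_Kurzweil_Integration.integral_cong)
      fix s assume "s \<in> {0..N}"
      then show "((\<lambda>y. exp (- l * h) *\<^sub>R G h y) \<circ> P) s = (P \<circ> (\<lambda>s. s + h)) s"
        using h G_add[of h s x]
        by (simp add: P_def scaleR add.commute[of s h] distrib_left exp_add[symmetric])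
    qed
    also have "\<dots> = integral {h..N + h} P" using integral_shift_real_ivl[of h h "N + h" P] by (simp add: o_def)
    also have "\<dots> = integral {0..N + h} P - integral {0..h} P"
      using Henstock_Kurzweil_Integration.integral_combine[of 0 h "N + h" P] h assms(1)
        integrable_continuous_real[OF cont] by (simp add: algebra_simps)
    finally show ?thesis .
  qed
  have lim: "((\<lambda>h. (1 / h) *\<^sub>R (exp (- l * h) *\<^sub>R G h (z x) - z x)) \<longlongrightarrow> P N - P 0) (at_right 0)"
  proof (rule Lim_transform_eventually)
    show "((\<lambda>h. (1 / h) *\<^sub>R (integral {0..N + h} P - integral {0..N} P) -
        (1 / h) *\<^sub>R (integral {0..0 + h} P - integral {0..0} P)) \<longlongrightarrow> P N - P 0) (at_right 0)"
      using assms(1) by (intro tendsto_diff tendsto_difference_quotient_integral[of _ "N + 1"] cont) auto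
    show "\<forall>\<^sub>F h in at_right 0. (1 / h) *\<^sub>R (integral {0..N + h} P - integral {0..N} P) -
        (1 / h) *\<^sub>R (integral {0..0 + h} P - integral {0..0} P) =
        (1 / h) *\<^sub>R (exp (- l * h) *\<^sub>R G h (z x) - z x)"
      using eventually_at_right_less
      by eventually_elim (use shift in \<open>simp add: scaleR_diff_right[symmetric] z\<close>)
  qed
  have exp_lim: "((\<lambda>h. exp (l * h)) \<longlongrightarrow> 1) (at_right 0)"
    using tendsto_exp[OF tendsto_mult_right_zero[OF tendsto_ident_at[of 0 "{0<..}"]], of l]
    by (simp add: mult.commute)
  have exp_deriv: "((\<lambda>h. (exp (l * h) - 1) / h) \<longlongrightarrow> l) (at_right 0)"
  proof -
    have "((\<lambda>h. exp (l * h)) has_real_derivative l) (at 0 within {0<..})"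
      by (auto intro!: derivative_eq_intros)
    then show ?thesis by (simp add: has_field_derivative_iff)
  qed
  \<comment> \<open>Return from the rescaled semigroup to \<open>G\<close>: the increment of G(h) is
    exp(l h) times the rescaled increment plus (exp(l h) - 1) times the identity. The second term
    contributes \<open>l *\<^sub>R z x\<close>.\<close>
  have "((\<lambda>h. exp (l * h) *\<^sub>R ((1 / h) *\<^sub>R (exp (- l * h) *\<^sub>R G h (z x) - z x)) +
      ((exp (l * h) - 1) / h) *\<^sub>R z x) \<longlongrightarrow> 1 *\<^sub>R (P N - P 0) + l *\<^sub>R z x) (at_right 0)"
    by (intro tendsto_intros exp_lim lim exp_deriv)
  moreover have "\<forall>\<^sub>F h in at_right 0. exp (l * h) *\<^sub>R ((1 / h) *\<^sub>R (exp (- l * h) *\<^sub>R G h (z x) - z x)) +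
      ((exp (l * h) - 1) / h) *\<^sub>R z x = (1 / h) *\<^sub>R (G h (z x) - z x)"
    using eventually_at_right_less
  proof eventually_elim
    case (elim h)
    have "exp (l * h) * exp (- l * h) = 1" by (simp add: exp_add[symmetric])
    then show ?case using elim
      by (simp add: scaleR_diff_right scaleR_diff_left diff_divide_distrib)
  qed
  ultimately have
    "((\<lambda>h. (1 / h) *\<^sub>R (G h (z x) - z x)) \<longlongrightarrow> 1 *\<^sub>R (P N - P 0) + l *\<^sub>R z x) (at_right 0)"
    by (rule Lim_transform_eventually)
  from generatorI[OF this] show "z x \<in> D" "A (z x) = l *\<^sub>R z x - (x - exp (- l * N) *\<^sub>R G N x)"
    by (simp_all add: P_def)
qed

text \<open>The means of an orbit over short intervals starting at 0 converge to its initial value.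
  They lie in \<open>D\<close> by \<open>integral_orbit_in_D\<close> with
  \<open>l = 0\<close>.\<close>

lemma closure_D: "closure D = UNIV"
proof -
  have "x \<in> closure D" for x
  proof (rule closed_sequentially[OF closed_closure])
    have "((\<lambda>h. (1 / h) *\<^sub>R (integral {0..0 + h} (\<lambda>s. G s x) - integral {0..0} (\<lambda>s. G s x)))
        \<longlongrightarrow> G 0 x) (at_right 0)"
      by (rule tendsto_difference_quotient_integral[of _ 1])
        (auto intro: continuous_on_subset[OF continuous_on_G])
    then have lim: "((\<lambda>h. (1 / h) *\<^sub>R integral {0..h} (\<lambda>s. G s x)) \<longlongrightarrow> x) (at_right 0)" by simp
    have "filterlim (\<lambda>n. 1 / real (Suc n)) (at_right 0) sequentially"
      unfolding filterlim_at
      using LIMSEQ_Suc[OF lim_1_over_n] by (auto intro!: always_eventually)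
    from filterlim_compose[OF lim this]
    show "(\<lambda>n. (1 / (1 / real (Suc n))) *\<^sub>R integral {0..1 / real (Suc n)} (\<lambda>s. G s x)) \<longlonglongrightarrow> x" .
    show "(1 / (1 / real (Suc n))) *\<^sub>R integral {0..1 / real (Suc n)} (\<lambda>s. G s x) \<in> closure D" for n
      using integral_orbit_in_D[of "1 / real (Suc n)" 0 x]
      by (intro subsetD[OF closure_subset] D_scaleR) simp
  qed
  then show ?thesis by blast
qed

text \<open>The equivalent norm in which \<^term>\<open>exp (- \<omega> * t) *\<^sub>R G t x\<close> is contractive.\<close>

definition renorm :: "'x \<Rightarrow> real" where
  "renorm x = (SUP t\<in>{0..}. exp (- \<omega> * t) * norm (G t x))"

lemma renorm_bdd: "0 \<le> t \<Longrightarrow> exp (- \<omega> * t) * norm (G t x) \<le> M * norm x"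
proof -
  assume "0 \<le> t"
  then have "exp (- \<omega> * t) * norm (G t x) \<le> exp (- \<omega> * t) * (M * exp (\<omega> * t) * norm x)"
    by (intro mult_left_mono growth) auto
  also have "\<dots> = (exp (- \<omega> * t) * exp (\<omega> * t)) * (M * norm x)" by (simp only: ac_simps)
  also have "exp (- \<omega> * t) * exp (\<omega> * t) = 1" by (simp add: exp_add[symmetric])
  finally show ?thesis by simp
qed

text \<open>Guarantees that the real supremum in \<open>renorm\<close> is a genuine least upper
  bound.\<close>

lemma bdd_above_renorm: "bdd_above ((\<lambda>t. exp (- \<omega> * t) * norm (G t x)) ` {0..})"
  by (rule bdd_aboveI2[of _ _ "M * norm x"]) (rule renorm_bdd, simp)

lemma le_renorm: "0 \<le> t \<Longrightarrow> exp (- \<omega> * t) * norm (G t x) \<le> renorm x"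
  unfolding renorm_def by (rule cSUP_upper[OF _ bdd_above_renorm]) simp

lemma renorm_le_iff: "renorm x \<le> c \<longleftrightarrow> (\<forall>t\<ge>0. exp (- \<omega> * t) * norm (G t x) \<le> c)"
  unfolding renorm_def by (subst cSUP_le_iff[OF _ bdd_above_renorm]) auto

lemma norm_le_renorm: "norm x \<le> renorm x"
  using le_renorm[of 0 x] by simp

lemma renorm_le: "renorm x \<le> M * norm x"
  by (simp only: renorm_le_iff) (blast intro: renorm_bdd)

lemma renorm_triangle: "renorm (x + y) \<le> renorm x + renorm y"
  unfolding renorm_le_iff
proof (intro allI impI)
  fix t :: real assume t: "0 \<le> t"
  interpret bounded_linear "G t" using t by (rule bounded_linear_G)
  have "exp (- \<omega> * t) * norm (G t (x + y)) \<le> exp (- \<omega> * t) * norm (G t x) + exp (- \<omega> * t) * norm (G t y)"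
    by (simp add: add distrib_left[symmetric] norm_triangle_ineq)
  with le_renorm[OF t, of x] le_renorm[OF t, of y]
  show "exp (- \<omega> * t) * norm (G t (x + y)) \<le> renorm x + renorm y" by linarith
qed

lemma renorm_scaleR_le: "renorm (c *\<^sub>R x) \<le> \<bar>c\<bar> * renorm x"
  unfolding renorm_le_iff
proof (intro allI impI)
  fix t :: real assume t: "0 \<le> t"
  interpret bounded_linear "G t" using t by (rule bounded_linear_G)
  show "exp (- \<omega> * t) * norm (G t (c *\<^sub>R x)) \<le> \<bar>c\<bar> * renorm x"
    using mult_left_mono[OF le_renorm[OF t, of x], of "\<bar>c\<bar>"] by (simp add: scaleR mult.left_commute)
qed

lemma renorm_G_le: "0 \<le> t \<Longrightarrow> renorm (G t x) \<le> exp (\<omega> * t) * renorm x"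
  unfolding renorm_le_iff
proof (intro allI impI)
  fix s :: real assume s: "0 \<le> s" and t: "0 \<le> t"
  have "exp (- \<omega> * s) * norm (G s (G t x)) = exp (\<omega> * t) * (exp (- \<omega> * (s + t)) * norm (G (s + t) x))"
    using s t by (simp add: G_add mult.assoc[symmetric] exp_add[symmetric] algebra_simps)
  also have "\<dots> \<le> exp (\<omega> * t) * renorm x"
    using s t by (intro mult_left_mono le_renorm) auto
  finally show "exp (- \<omega> * s) * norm (G s (G t x)) \<le> exp (\<omega> * t) * renorm x" .
qed

text \<open>In the new norm G(h) grows by at most exp(\<omega> h), without the factor
  \<open>M\<close>. Comparing (1 + l h) x with G(h) x to first order in h and letting h tend to 0
  gives the estimate. It yields both injectivity of l - A and a resolvent bound that can be
  iterated.\<close>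

lemma dissipative:
  assumes x: "x \<in> D"
  shows "(l - \<omega>) * renorm x \<le> renorm (l *\<^sub>R x - A x)"
proof -
  define y where "y = l *\<^sub>R x - A x"
  define q where "q = (\<lambda>h. (1 / h) *\<^sub>R (G h x - x))"
  have q: "(q \<longlongrightarrow> A x) (at_right 0)" unfolding q_def by (rule generator_tendsto[OF x])
  have exp_deriv: "((\<lambda>h. (exp (\<omega> * h) - 1) / h) \<longlongrightarrow> \<omega>) (at_right 0)"
  proof -
    have "((\<lambda>h. exp (\<omega> * h)) has_real_derivative \<omega>) (at 0 within {0<..})"
      by (auto intro!: derivative_eq_intros)
    then show ?thesis by (simp add: has_field_derivative_iff)
  qed
  have "((\<lambda>h. 1 + l * h) \<longlongrightarrow> 1 + l * 0) (at_right 0)" by (intro tendsto_intros)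
  then have pos: "\<forall>\<^sub>F h in at_right 0. 0 < 1 + l * h" by (rule order_tendstoD) simp
  have "l * renorm x \<le> \<omega> * renorm x + renorm y + M * norm (A x - A x)"
  proof (rule tendsto_le[of "at_right (0::real)"])
    show "((\<lambda>h. (exp (\<omega> * h) - 1) / h * renorm x + renorm y + M * norm (A x - q h)) \<longlongrightarrow>
        \<omega> * renorm x + renorm y + M * norm (A x - A x)) (at_right 0)"
      by (intro tendsto_intros exp_deriv q)
    show "\<forall>\<^sub>F h in at_right 0. l * renorm x \<le>
        (exp (\<omega> * h) - 1) / h * renorm x + renorm y + M * norm (A x - q h)"
      using eventually_at_right_less pos
    proof eventually_elim
      case (elim h)
      \<comment> \<open>Since \<open>y\<close> is l x - A x, the defect of this first-order
        expansion is h times the error of the difference quotient \<open>q h\<close>, which vanishes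
        in the limit.\<close>
      have "(1 + l * h) *\<^sub>R x = G h x + (h *\<^sub>R y + h *\<^sub>R (A x - q h))"
        using elim by (simp add: y_def q_def algebra_simps)
      then have "renorm ((1 + l * h) *\<^sub>R x) \<le> renorm (G h x) + (renorm (h *\<^sub>R y) + renorm (h *\<^sub>R (A x - q h)))"
        using renorm_triangle[of "G h x"] renorm_triangle[of "h *\<^sub>R y" "h *\<^sub>R (A x - q h)"]
        by (metis add_left_mono order_trans)
      also have "\<dots> \<le> exp (\<omega> * h) * renorm x + (h * renorm y + h * (M * norm (A x - q h)))"
        using renorm_G_le[of h x] renorm_scaleR_le[of h y] elim
          order_trans[OF renorm_le[of "h *\<^sub>R (A x - q h)"]]
        by (intro add_mono) (auto simp: mult.left_commute)
      finally have "renorm ((1 + l * h) *\<^sub>R x) \<le> exp (\<omega> * h) * renorm x + h * renorm y + h * (M * norm (A x - q h))"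
        by simp
      \<comment> \<open>The lower estimate for a multiple follows from the upper one
        \<open>renorm_scaleR_le\<close>, applied with the inverse scalar; \<open>pos\<close> makes
        that scalar positive.\<close>
      moreover have "(1 + l * h) * renorm x \<le> renorm ((1 + l * h) *\<^sub>R x)"
        using renorm_scaleR_le[of "inverse (1 + l * h)" "(1 + l * h) *\<^sub>R x"] elim
        by (simp add: pos_le_divide_eq mult.commute inverse_eq_divide)
      moreover have "h * ((exp (\<omega> * h) - 1) / h * renorm x) = exp (\<omega> * h) * renorm x - renorm x"
        using elim by (simp add: left_diff_distrib)
      ultimately have "h * (l * renorm x) \<le>
          h * ((exp (\<omega> * h) - 1) / h * renorm x + renorm y + M * norm (A x - q h))"
        unfolding distrib_left distrib_right by (simp add: mult_ac)
      then show ?case using elim by simp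
    qed
  qed auto
  then show ?thesis by (simp add: y_def left_diff_distrib)
qed

lemma surj_generator:
  assumes "\<omega> < l"
  shows "\<exists>z\<in>D. l *\<^sub>R z - A z = y"
proof -
  \<comment> \<open>Chosen so that exp(-l N) M exp(\<omega> N) equals 1/2. The map \<open>f\<close>
    below is then a strict contraction, and its fixed point x solves x - exp(-l N) G(N) x =
    y.\<close>
  define N where "N = ln (2 * M) / (l - \<omega>)"
  have "N \<ge> 0" using assms M_ge_1 by (simp add: N_def)
  interpret bounded_linear "G N" using \<open>N \<ge> 0\<close> by (rule bounded_linear_G)
  have "exp (- l * N) * (M * exp (\<omega> * N)) = M * exp (- ((l - \<omega>) * N))"
    by (simp add: mult.left_commute exp_add[symmetric] algebra_simps)
  also have "(l - \<omega>) * N = ln (2 * M)" using assms by (simp add: N_def)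
  finally have half: "exp (- l * N) * (M * exp (\<omega> * N)) = 1 / 2"
    using M_ge_1 by (simp add: exp_minus)
  define f where "f = (\<lambda>x. y + exp (- l * N) *\<^sub>R G N x)"
  have "dist (f u) (f v) \<le> 1 / 2 * dist u v" for u v
  proof -
    have "f u - f v = exp (- l * N) *\<^sub>R G N (u - v)" by (simp add: f_def diff scaleR_diff_right)
    then have "dist (f u) (f v) = exp (- l * N) * norm (G N (u - v))" by (simp add: dist_norm)
    also have "\<dots> \<le> exp (- l * N) * (M * exp (\<omega> * N) * norm (u - v))"
      using \<open>N \<ge> 0\<close> by (intro mult_left_mono growth) auto
    also have "\<dots> = 1 / 2 * dist u v" using half by (simp add: dist_norm mult.assoc[symmetric])
    finally show ?thesis .
  qed
  then obtain x where "f x = x" using banach_fix_type[of "1 / 2" f] by auto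
  then have "x - exp (- l * N) *\<^sub>R G N x = y" by (simp add: f_def algebra_simps)
  then show ?thesis
    using integral_orbit_in_D[OF \<open>N \<ge> 0\<close>, of l x] A_integral_orbit[OF \<open>N \<ge> 0\<close>, of l x]
    by (intro bexI) auto
qed

lemma inj_generator:
  assumes "\<omega> < l" "u \<in> D" "v \<in> D" "l *\<^sub>R u - A u = l *\<^sub>R v - A v"
  shows "u = v"
proof -
  have "l *\<^sub>R (u - v) - A (u - v) = 0" using assms by (simp add: A_diff algebra_simps)
  with dissipative[OF D_diff[OF assms(2,3)], of l] have "(l - \<omega>) * renorm (u - v) \<le> renorm 0" by simp
  with renorm_le[of 0] have "(l - \<omega>) * renorm (u - v) \<le> 0" by simp
  then have "renorm (u - v) \<le> 0" using assms(1) by (simp add: mult_le_0_iff)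
  with norm_le_renorm[of "u - v"] have "norm (u - v) \<le> 0" by linarith
  then show ?thesis by simp
qed

section \<open>The resolvent to the right of the growth bound\<close>

abbreviation R :: "real \<Rightarrow> 'x \<Rightarrow> 'x" where "R \<equiv> resolvent type_space D A"

lemma bij_betw_generator: "\<omega> < l \<Longrightarrow> bij_betw (\<lambda>x. l *\<^sub>R x - A x) D UNIV"
proof (rule bij_betwI')
  assume l: "\<omega> < l"
  show "\<exists>x\<in>D. y = l *\<^sub>R x - A x" for y using surj_generator[OF l, of y] by metis
qed (auto dest: inj_generator)

lemma
  assumes "\<omega> < l"
  shows R_in_D: "R l y \<in> D"
    and A_R: "A (R l y) = l *\<^sub>R R l y - y"
    and R_eqI: "x \<in> D \<Longrightarrow> l *\<^sub>R x - A x = y \<Longrightarrow> R l y = x"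
proof -
  have r: "R l = inv_into D (\<lambda>x. l *\<^sub>R x - A x)" by (simp add: resolvent_def)
  note b = bij_betw_generator[OF assms]
  show 1: "R l y \<in> D" using b unfolding r by (metis UNIV_I bij_betw_def inv_into_into)
  have 2: "l *\<^sub>R R l y - A (R l y) = y"
    using bij_betw_inv_into_right[OF b, of y] unfolding r by simp
  then show "A (R l y) = l *\<^sub>R R l y - y" by (simp add: algebra_simps)
  show "R l y = x" if "x \<in> D" "l *\<^sub>R x - A x = y"
    using inj_generator[OF assms 1 that(1)] 2 that(2) by simp
qed

lemma R_G: "\<omega> < l \<Longrightarrow> 0 \<le> t \<Longrightarrow> R l (G t x) = G t (R l x)"
proof -
  assume l: "\<omega> < l" and t: "0 \<le> t"
  interpret bounded_linear "G t" using t by (rule bounded_linear_G)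
  show ?thesis
    using R_in_D[OF l, of x] t by (intro R_eqI[OF l]) (simp_all add: D_G A_G A_R[OF l] diff scaleR)
qed

text \<open>The constant 1/(l - \<omega>) carries no factor \<open>M\<close>, so powers of the
  resolvent do not accumulate powers of \<open>M\<close>.\<close>

lemma renorm_R_le: "\<omega> < l \<Longrightarrow> (l - \<omega>) * renorm (R l x) \<le> renorm x"
  using dissipative[OF R_in_D, of l l x] by (simp add: A_R)

lemma norm_R_le:
  assumes "\<omega> < l"
  shows "norm (R l x) \<le> M / (l - \<omega>) * norm x"
proof -
  have "(l - \<omega>) * norm (R l x) \<le> (l - \<omega>) * renorm (R l x)"
    using assms by (intro mult_left_mono norm_le_renorm) auto
  also have "\<dots> \<le> M * norm x" using renorm_R_le[OF assms, of x] renorm_le[of x] by linarith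
  finally show ?thesis using assms by (simp add: pos_le_divide_eq mult.commute)
qed

lemma bounded_linear_R:
  assumes "\<omega> < l"
  shows "bounded_linear (R l)"
proof (rule bounded_linear_intro[where K = "M / (l - \<omega>)"])
  note RD = R_in_D[OF assms] and AR = A_R[OF assms]
  show "R l (x + y) = R l x + R l y" for x y
    by (rule R_eqI[OF assms D_add[OF RD RD]]) (simp add: A_add[OF RD RD] AR algebra_simps)
  show "R l (c *\<^sub>R x) = c *\<^sub>R R l x" for c x
    by (rule R_eqI[OF assms D_scaleR[OF RD]]) (simp add: A_scaleR[OF RD] AR algebra_simps)
  show "norm (R l x) \<le> norm x * (M / (l - \<omega>))" for x
    using norm_R_le[OF assms, of x] by (simp add: mult.commute)
qed

text \<open>
  Convergence of the difference quotients along a single sequence suffices, because the resolvent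
  maps them to convergent ones.
\<close>

lemma generatorI_sequentially:
  assumes h: "filterlim h (at_right 0) sequentially"
    and lim: "(\<lambda>n. (1 / h n) *\<^sub>R (G (h n) x - x)) \<longlonglongrightarrow> y"
  shows "x \<in> D" "A x = y"
proof -
  define l where "l = \<omega> + 1"
  have l: "\<omega> < l" by (simp add: l_def)
  interpret bounded_linear "R l" by (rule bounded_linear_R[OF l])
  have pos: "\<forall>\<^sub>F n in sequentially. 0 < h n"
    by (rule eventually_compose_filterlim[OF eventually_at_right_less h])
  have "(\<lambda>n. R l ((1 / h n) *\<^sub>R (G (h n) x - x))) \<longlonglongrightarrow> R l y" by (rule tendsto[OF lim])
  moreover have "\<forall>\<^sub>F n in sequentially.
      R l ((1 / h n) *\<^sub>R (G (h n) x - x)) = (1 / h n) *\<^sub>R (G (h n) (R l x) - R l x)"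
    using pos by eventually_elim (simp add: scaleR diff R_G[OF l])
  ultimately have "(\<lambda>n. (1 / h n) *\<^sub>R (G (h n) (R l x) - R l x)) \<longlonglongrightarrow> R l y"
    by (rule Lim_transform_eventually)
  moreover have "(\<lambda>n. (1 / h n) *\<^sub>R (G (h n) (R l x) - R l x)) \<longlonglongrightarrow> A (R l x)"
    by (rule filterlim_compose[OF generator_tendsto[OF R_in_D[OF l]] h])
  ultimately have "R l y = A (R l x)" by (rule LIMSEQ_unique)
  then have "R l y = l *\<^sub>R R l x - x" by (simp only: A_R[OF l])
  \<comment> \<open>The two limits show that \<open>x\<close> lies in the range of the resolvent,
    hence in \<open>D\<close>; its preimage under \<open>R l\<close> also determines
    \<open>A x\<close>.\<close>
  then have x: "x = R l (l *\<^sub>R x - y)" by (simp add: scaleR diff)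
  from R_in_D[OF l, of "l *\<^sub>R x - y"] show "x \<in> D" unfolding x[symmetric] .
  show "A x = y" using A_R[OF l, of "l *\<^sub>R x - y"] unfolding x[symmetric] by simp
qed

text \<open>Cut the interval from 0 to \<open>h\<close> into n equal pieces. Each increment is at
  most \<open>K\<close> times the first one, and n times the first increment is \<open>h\<close>
  times the norm of a difference quotient with step h/n, which tends to the norm of
  \<open>A x\<close>. The estimate later supplies an integrable majorant for the difference
  quotients.\<close>

lemma norm_G_diff_id_le:
  assumes x: "x \<in> D" and h: "0 \<le> h" "h \<le> 1"
  shows "norm (G h x - x) \<le> h * (M * exp \<bar>\<omega>\<bar> * norm (A x))"
proof (cases "h = 0")
  case False
  define K where "K = M * exp \<bar>\<omega>\<bar>"
  have *: "norm (G (real j * k) x - x) \<le> real j * (K * norm (G k x - x))"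
    if "0 \<le> k" "real j * k \<le> 1" for j k
    using that(2)
  proof (induction j)
    case (Suc j)
    have 1: "real j * k \<le> 1" "0 \<le> real j * k" using Suc.prems that(1) by (auto simp: algebra_simps)
    have "norm (G (real (Suc j) * k) x - G (real j * k) x) \<le> K * norm (G k x - x)"
      using norm_G_diff_le[of "real j * k" "real (Suc j) * k" 1 x] 1 that(1) Suc.prems
      by (simp add: K_def algebra_simps)
    with Suc.IH[OF 1(1)] norm_triangle_ineq[of "G (real (Suc j) * k) x - G (real j * k) x" "G (real j * k) x - x"]
    show ?case by (simp add: algebra_simps)
  qed simp
  have lim: "filterlim (\<lambda>n. h / real (Suc n)) (at_right 0) sequentially"
    unfolding filterlim_at using LIMSEQ_Suc[OF lim_const_over_n[of h]] False h
    by (auto intro!: always_eventually)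
  have "norm (G h x - x) \<le> h * (K * norm (A x))"
  proof (rule tendsto_lowerbound)
    show "(\<lambda>n. h * (K * norm ((1 / (h / real (Suc n))) *\<^sub>R (G (h / real (Suc n)) x - x))))
        \<longlonglongrightarrow> h * (K * norm (A x))"
      by (intro tendsto_intros filterlim_compose[OF generator_tendsto[OF x] lim])
    have "norm (G h x - x) \<le> h * (K * norm ((1 / (h / real (Suc n))) *\<^sub>R (G (h / real (Suc n)) x - x)))" for n
    proof -
      have "h * (K * norm ((1 / (h / real (Suc n))) *\<^sub>R (G (h / real (Suc n)) x - x))) =
          real (Suc n) * (K * norm (G (h / real (Suc n)) x - x))"
        using h False by simp
      with *[of "h / real (Suc n)" "Suc n"] h show ?thesis by simp
    qed
    then show "\<forall>\<^sub>F n in sequentially. norm (G h x - x) \<le>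
        h * (K * norm ((1 / (h / real (Suc n))) *\<^sub>R (G (h / real (Suc n)) x - x)))" by simp
  qed simp
  then show ?thesis by (simp add: K_def)
qed simp

end

text \<open>The elementary direction of the Banach-Steinhaus principle: a common bound carries
  convergence from a dense set to the whole space.\<close>

lemma tendsto_zero_dense:
  fixes B :: "'i \<Rightarrow> 'a::real_normed_vector \<Rightarrow> 'b::real_normed_vector"
  assumes S: "closure S = UNIV"
    and bound: "\<forall>\<^sub>F n in F. bounded_linear (B n) \<and> (\<forall>x. norm (B n x) \<le> C * norm x)"
    and S_lim: "\<And>x. x \<in> S \<Longrightarrow> ((\<lambda>n. B n x) \<longlongrightarrow> 0) F"
  shows "((\<lambda>n. B n x) \<longlongrightarrow> 0) F"
proof (rule tendstoI)
  fix e :: real assume "e > 0"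
  \<comment> \<open>The sign of \<open>C\<close> is unrestricted; its absolute value plus 1 is a
    positive upper bound.\<close>
  then have "e / (2 * (\<bar>C\<bar> + 1)) > 0" by simp
  then obtain y where "y \<in> S" and y: "norm (y - x) < e / (2 * (\<bar>C\<bar> + 1))"
    using S unfolding closure_approachable[of x S, unfolded dist_norm] set_eq_iff
    by (metis UNIV_I closure_approachable dist_norm)
  have "\<forall>\<^sub>F n in F. dist (B n y) 0 < e / 2"
    using S_lim[OF \<open>y \<in> S\<close>] \<open>e > 0\<close> by (intro tendstoD) auto
  with bound show "\<forall>\<^sub>F n in F. dist (B n x) 0 < e"
  proof eventually_elim
    case (elim n)
    then interpret bounded_linear "B n" by simp
    have "norm (B n (y - x)) \<le> C * norm (y - x)" using elim by blast
    also have "\<dots> \<le> (\<bar>C\<bar> + 1) * norm (y - x)" by (intro mult_right_mono) auto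
    also have "\<dots> < e / 2" using y by (simp add: field_simps)
    finally have "norm (B n y - B n x) < e / 2" by (simp add: diff)
    with elim norm_triangle_ineq4[of "B n y" "B n y - B n x"] show ?case by simp
  qed
qed

lemma bounded_linear_funpow:
  fixes f :: "'a::real_normed_vector \<Rightarrow> 'a"
  shows "bounded_linear f \<Longrightarrow> bounded_linear (f ^^ n)"
proof (induction n)
  case 0
  show ?case using bounded_linear_ident by (simp add: id_def)
next
  case (Suc n)
  then show ?case using bounded_linear_compose[of f "f ^^ n"] by (simp add: o_def)
qed

text \<open>Telescoping the difference of powers of commuting operators, with a - b acting first in
  every term. Bounds on the powers, rather than powers of bounds, keep the constant linear in
  \<open>n\<close>.\<close>

lemma norm_funpow_diff_le:
  fixes a b :: "'a::real_normed_vector \<Rightarrow> 'a"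
  assumes lin: "bounded_linear a" "bounded_linear b" and comm: "\<And>x. a (b x) = b (a x)"
    and a: "\<And>k x. k \<le> n \<Longrightarrow> norm ((a ^^ k) x) \<le> C1 * norm x"
    and b: "\<And>k x. k \<le> n \<Longrightarrow> norm ((b ^^ k) x) \<le> C2 * norm x"
    and C2: "0 \<le> C2"
  shows "norm ((a ^^ n) x - (b ^^ n) x) \<le> real n * (C2 * (C1 * norm (a x - b x)))"
proof -
  \<comment> \<open>The leading power of \<open>b\<close> strengthens the induction: the inner
    factor \<open>b\<close> produced at each stage is absorbed into it, so only bounds on whole
    powers are applied.\<close>
  have "norm ((b ^^ j) ((a ^^ k) x - (b ^^ k) x)) \<le> real k * (C2 * (C1 * norm (a x - b x)))"
    if "j + k \<le> n" for j k
    using that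
  proof (induction k arbitrary: j)
    case 0
    have "(b ^^ j) 0 = 0"
      by (rule linear_0[OF bounded_linear.linear[OF bounded_linear_funpow[OF lin(2)]]])
    then show ?case by simp
  next
    case (Suc k)
    interpret a: bounded_linear "a ^^ k" by (rule bounded_linear_funpow[OF lin(1)])
    interpret b: bounded_linear b by (rule lin(2))
    interpret bj: bounded_linear "b ^^ j" by (rule bounded_linear_funpow[OF lin(2)])
    have "(a ^^ k) (b x) = b ((a ^^ k) x)" by (induction k) (simp_all add: comm)
    then have "(a ^^ Suc k) x - (b ^^ Suc k) x =
        (a ^^ k) (a x - b x) + b ((a ^^ k) x - (b ^^ k) x)"
      by (simp add: funpow_swap1 a.diff b.diff)
    then have "(b ^^ j) ((a ^^ Suc k) x - (b ^^ Suc k) x) =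
        (b ^^ j) ((a ^^ k) (a x - b x)) + (b ^^ Suc j) ((a ^^ k) x - (b ^^ k) x)"
      by (simp add: bj.add funpow_swap1)
    moreover have "norm ((b ^^ j) ((a ^^ k) (a x - b x))) \<le> C2 * (C1 * norm (a x - b x))"
      using b[of j "(a ^^ k) (a x - b x)"] a[of k "a x - b x"] Suc.prems C2
      by (meson add_leD1 add_leD2 Suc_leD mult_left_mono order_trans le_add1 add_Suc_right)
    moreover have "norm ((b ^^ Suc j) ((a ^^ k) x - (b ^^ k) x)) \<le>
        real k * (C2 * (C1 * norm (a x - b x)))"
      using Suc.prems by (intro Suc.IH) simp
    ultimately show ?case
      using norm_triangle_ineq[of "(b ^^ j) ((a ^^ k) (a x - b x))" "(b ^^ Suc j) ((a ^^ k) x - (b ^^ k) x)"]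
      by (simp add: distrib_right)
  qed
  from this[of 0 n] show ?thesis by simp
qed

section \<open>Implicit Euler steps and the exponential formula\<close>

context exp_bounded_semigroup
begin

text \<open>One implicit Euler step of length 1/l, that is, the inverse of I - A/l.\<close>

definition V :: "real \<Rightarrow> 'x \<Rightarrow> 'x" where
  "V l x = l *\<^sub>R R l x"

lemma bounded_linear_V: "\<omega> < l \<Longrightarrow> bounded_linear (V l)"
  unfolding V_def by (intro bounded_linear_const_scaleR bounded_linear_R)

lemma V_G: "\<omega> < l \<Longrightarrow> 0 \<le> t \<Longrightarrow> V l (G t x) = G t (V l x)"
proof -
  assume l: "\<omega> < l" and t: "0 \<le> t"
  interpret bounded_linear "G t" using t by (rule bounded_linear_G)
  show ?thesis by (simp add: V_def R_G[OF l t] scaleR)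
qed

text \<open>In the new norm one step costs a factor l/(l - \<omega>), which is at most 1 +
  2|\<omega>|/l and hence at most exp(2|\<omega>|/l). These exponents add up over \<open>k\<close>
  steps, and \<open>M\<close> appears once, when the original norm is restored.\<close>

lemma norm_V_funpow_le:
  assumes l: "0 < l" "2 * \<bar>\<omega>\<bar> \<le> l"
  shows "norm ((V l ^^ k) x) \<le> M * exp (2 * \<bar>\<omega>\<bar> * real k / l) * norm x"
proof -
  have "\<omega> < l" using l by linarith
  \<comment> \<open>Multiplied by l, this says that l^2 is at most (l - \<omega>)(l + 2|\<omega>|).
    For positive \<open>\<omega>\<close> this is where l must be at least 2|\<omega>|.\<close>
  have 1: "l \<le> (l - \<omega>) * (1 + 2 * \<bar>\<omega>\<bar> / l)"
  proof -
    have "0 \<le> (2 * \<bar>\<omega>\<bar> - \<omega>) * l - 2 * \<bar>\<omega>\<bar> * \<omega>"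
    proof (cases "\<omega> \<le> 0")
      case False
      then have "\<omega> * (2 * \<omega>) \<le> \<omega> * l" using l by (intro mult_left_mono) auto
      then show ?thesis using False by simp
    next
      case True
      then have "2 * \<bar>\<omega>\<bar> * \<omega> \<le> 0" by (simp add: mult_nonneg_nonpos)
      moreover have "0 \<le> (2 * \<bar>\<omega>\<bar> - \<omega>) * l" using l True by (intro mult_nonneg_nonneg) auto
      ultimately show ?thesis by linarith
    qed
    then show ?thesis using l by (simp add: field_simps)
  qed
  have step: "renorm (V l y) \<le> exp (2 * \<bar>\<omega>\<bar> / l) * renorm y" for y
  proof -
    have "renorm (V l y) \<le> l * renorm (R l y)"
      using renorm_scaleR_le[of l "R l y"] l by (simp add: V_def)
    also have "\<dots> \<le> (l - \<omega>) * (1 + 2 * \<bar>\<omega>\<bar> / l) * renorm (R l y)"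
      using norm_le_renorm[of "R l y"] norm_ge_zero[of "R l y"]
      by (intro mult_right_mono 1) linarith
    also have "\<dots> \<le> (1 + 2 * \<bar>\<omega>\<bar> / l) * renorm y"
      using mult_left_mono[OF renorm_R_le[OF \<open>\<omega> < l\<close>, of y], of "1 + 2 * \<bar>\<omega>\<bar> / l"] l
      by (simp add: mult_ac)
    also have "\<dots> \<le> exp (2 * \<bar>\<omega>\<bar> / l) * renorm y"
      using norm_le_renorm[of y] norm_ge_zero[of y]
      by (intro mult_right_mono exp_ge_add_one_self) linarith
    finally show ?thesis .
  qed
  have "renorm ((V l ^^ k) x) \<le> exp (2 * \<bar>\<omega>\<bar> * real k / l) * renorm x"
  proof (induction k)
    case (Suc k)
    have "renorm ((V l ^^ Suc k) x) \<le> exp (2 * \<bar>\<omega>\<bar> / l) * renorm ((V l ^^ k) x)"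
      using step by simp
    also have "\<dots> \<le> exp (2 * \<bar>\<omega>\<bar> / l) * (exp (2 * \<bar>\<omega>\<bar> * real k / l) * renorm x)"
      using Suc.IH by (rule mult_left_mono) simp
    also have "\<dots> = exp (2 * \<bar>\<omega>\<bar> * real (Suc k) / l) * renorm x"
      by (simp add: mult.assoc[symmetric] exp_add[symmetric] add_divide_distrib distrib_left)
    finally show ?case .
  qed simp
  also have "\<dots> \<le> exp (2 * \<bar>\<omega>\<bar> * real k / l) * (M * norm x)"
    by (rule mult_left_mono[OF renorm_le]) simp
  finally show ?thesis using norm_le_renorm[of "(V l ^^ k) x"] by (simp add: mult_ac)
qed

lemma V_diff_id: "\<omega> < l \<Longrightarrow> x \<in> D \<Longrightarrow> V l x - x = R l (A x)"
proof -
  assume l: "\<omega> < l" and x: "x \<in> D"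
  interpret bounded_linear "R l" by (rule bounded_linear_R[OF l])
  have "R l (l *\<^sub>R x - A x) = x" by (rule R_eqI[OF l x refl])
  then show ?thesis by (simp add: V_def diff scaleR algebra_simps)
qed

lemma eventually_at_top_renorm: "\<forall>\<^sub>F l in at_top. 0 < l \<and> 2 * \<bar>\<omega>\<bar> \<le> l \<and> \<omega> < l"
  by (intro eventually_conj eventually_gt_at_top eventually_ge_at_top)

text \<open>On \<open>D\<close> the deviation from the identity is the resolvent applied to
  \<open>A x\<close>, of order 1/l. The bound on a single step extends the convergence to all of the
  space by density.\<close>

lemma tendsto_V: "((\<lambda>l. V l x) \<longlongrightarrow> x) at_top"
proof -
  have "((\<lambda>l. V l x - x) \<longlongrightarrow> 0) at_top"
  proof (rule tendsto_zero_dense[OF closure_D, where C = "M * exp 1 + 1"])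
    show "\<forall>\<^sub>F l in at_top. bounded_linear (\<lambda>x. V l x - x) \<and>
        (\<forall>x. norm (V l x - x) \<le> (M * exp 1 + 1) * norm x)"
      using eventually_at_top_renorm
    proof (eventually_elim, intro conjI allI)
      fix l :: real and x :: 'x assume l: "0 < l \<and> 2 * \<bar>\<omega>\<bar> \<le> l \<and> \<omega> < l"
      then show "bounded_linear (\<lambda>x. V l x - x)"
        by (intro bounded_linear_sub bounded_linear_V bounded_linear_ident) auto
      have "M * exp (2 * \<bar>\<omega>\<bar> / l) * norm x \<le> M * exp 1 * norm x"
        using l M_ge_1 by (intro mult_right_mono mult_left_mono) auto
      then have "norm (V l x) \<le> M * exp 1 * norm x"
        using norm_V_funpow_le[of l 1 x] l by simp
      then show "norm (V l x - x) \<le> (M * exp 1 + 1) * norm x"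
        using norm_triangle_ineq4[of "V l x" x] by (simp add: distrib_right)
    qed
  next
    fix x assume x: "x \<in> D"
    have "filterlim (\<lambda>l. l - \<omega>) at_top at_top"
      using filterlim_tendsto_add_at_top[OF tendsto_const filterlim_ident, of "- \<omega>"] by simp
    then have "((\<lambda>l. M / (l - \<omega>) * norm (A x)) \<longlongrightarrow> 0) at_top"
      by (intro tendsto_mult_left_zero real_tendsto_divide_at_top[OF tendsto_const])
    moreover have "\<forall>\<^sub>F l in at_top. norm (V l x - x) \<le> M / (l - \<omega>) * norm (A x)"
      using eventually_gt_at_top[of \<omega>]
      by eventually_elim (simp only: V_diff_id[OF _ x] norm_R_le)
    ultimately show "((\<lambda>l. V l x - x) \<longlongrightarrow> 0) at_top"
      by (rule Lim_null_comparison[rotated])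
  qed
  then show ?thesis by (simp add: LIM_zero_iff)
qed

text \<open>The implicit Euler scheme: consistency on \<^term>\<open>D\<close> and stability give convergence.\<close>

lemma tendsto_V_funpow:
  assumes t: "0 < t"
  shows "(\<lambda>n. (V (real n / t) ^^ n) x) \<longlonglongrightarrow> G t x"
proof -
  \<comment> \<open>Stability constants: \<open>C1\<close> bounds up to \<open>n\<close> Euler steps
    of length t/n, \<open>C2\<close> bounds the semigroup on the interval from 0 to
    \<open>t\<close>.\<close>
  define C1 where "C1 = M * exp (2 * \<bar>\<omega>\<bar> * t)"
  define C2 where "C2 = M * exp (\<bar>\<omega>\<bar> * t)"
  have C: "C1 \<ge> 0" "C2 \<ge> 0" using M_ge_1 by (auto simp: C1_def C2_def)
  have at_top: "filterlim (\<lambda>n. real n / t) at_top sequentially"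
    unfolding divide_inverse using t
    by (intro filterlim_at_top_mult_tendsto_pos[OF tendsto_const] filterlim_real_sequentially) auto
  have ev: "\<forall>\<^sub>F n in sequentially. 0 < n \<and> 0 < real n / t \<and> 2 * \<bar>\<omega>\<bar> \<le> real n / t \<and> \<omega> < real n / t"
    using eventually_gt_at_top[of 0] eventually_compose_filterlim[OF eventually_at_top_renorm at_top]
    by eventually_elim auto
  have V: "norm ((V (real n / t) ^^ k) z) \<le> C1 * norm z"
    if "0 < n \<and> 0 < real n / t \<and> 2 * \<bar>\<omega>\<bar> \<le> real n / t \<and> \<omega> < real n / t" "k \<le> n" for n k z
  proof -
    have "real k / (real n / t) \<le> t" using that t by (simp add: field_simps)
    then have "2 * \<bar>\<omega>\<bar> * (real k / (real n / t)) \<le> 2 * \<bar>\<omega>\<bar> * t" by (intro mult_left_mono) auto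
    then have "M * exp (2 * \<bar>\<omega>\<bar> * real k / (real n / t)) * norm z \<le> C1 * norm z"
      unfolding C1_def using M_ge_1 by (intro mult_right_mono mult_left_mono) auto
    with norm_V_funpow_le[of "real n / t" k z] that show ?thesis by linarith
  qed
  have G_pow: "(G (t / real n) ^^ k) z = G (real k * (t / real n)) z" for n k z
    using t by (induction k) (simp_all add: G_add[symmetric] distrib_right add_divide_distrib)
  have "(\<lambda>n. (V (real n / t) ^^ n) x - G t x) \<longlonglongrightarrow> 0"
  proof (rule tendsto_zero_dense[OF closure_D,
        where B = "\<lambda>n x. (V (real n / t) ^^ n) x - G t x" and C = "C1 + C2"])
    show "\<forall>\<^sub>F n in sequentially. bounded_linear (\<lambda>x. (V (real n / t) ^^ n) x - G t x) \<and>
        (\<forall>x. norm ((V (real n / t) ^^ n) x - G t x) \<le> (C1 + C2) * norm x)"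
      using ev
    proof (eventually_elim, intro conjI allI)
      fix n :: nat and x :: 'x assume n: "0 < n \<and> 0 < real n / t \<and> 2 * \<bar>\<omega>\<bar> \<le> real n / t \<and> \<omega> < real n / t"
      then show "bounded_linear (\<lambda>x. (V (real n / t) ^^ n) x - G t x)"
        using t by (intro bounded_linear_sub bounded_linear_funpow bounded_linear_V bounded_linear_G) auto
      show "norm ((V (real n / t) ^^ n) x - G t x) \<le> (C1 + C2) * norm x"
        using norm_triangle_ineq4[of "(V (real n / t) ^^ n) x" "G t x"] V[OF n, of n x]
          growth_le[of t t x] t by (simp add: C2_def distrib_right)
    qed
  next
    fix x assume x: "x \<in> D"
    \<comment> \<open>The local error of one step divided by its length t/n: on \<open>D\<close>
      both the Euler increment and the semigroup increment, divided by t/n, tend to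
      \<open>A x\<close>. The global error sums \<open>n\<close> local errors, so the factor
      \<open>n\<close> cancels against t/n and leaves \<open>t\<close>.\<close>
    define e where "e = (\<lambda>n. V (real n / t) (A x) - (1 / (t / real n)) *\<^sub>R (G (t / real n) x - x))"
    have k: "filterlim (\<lambda>n. t / real n) (at_right 0) sequentially"
      unfolding filterlim_at
    proof
      show "\<forall>\<^sub>F n in sequentially. t / real n \<in> {0<..} \<and> t / real n \<noteq> 0"
        using eventually_gt_at_top[of 0] by eventually_elim (use t in auto)
    qed (rule lim_const_over_n)
    have "e \<longlonglongrightarrow> A x - A x"
      unfolding e_def
      by (intro tendsto_diff filterlim_compose[OF tendsto_V at_top]
          filterlim_compose[OF generator_tendsto[OF x] k])
    then have "(\<lambda>n. t * (C2 * (C1 * norm (e n)))) \<longlonglongrightarrow> t * (C2 * (C1 * norm (A x - A x)))"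
      by (intro tendsto_intros)
    then have "(\<lambda>n. t * (C2 * (C1 * norm (e n)))) \<longlonglongrightarrow> 0" by simp
    moreover have "\<forall>\<^sub>F n in sequentially.
        norm ((V (real n / t) ^^ n) x - G t x) \<le> t * (C2 * (C1 * norm (e n)))"
      using ev
    proof eventually_elim
      case (elim n)
      have "norm ((V (real n / t) ^^ n) x - (G (t / real n) ^^ n) x) \<le>
          real n * (C2 * (C1 * norm (V (real n / t) x - G (t / real n) x)))"
      proof (rule norm_funpow_diff_le)
        show "norm ((G (t / real n) ^^ k) x) \<le> C2 * norm x" if "k \<le> n" for k x
          unfolding G_pow C2_def using that elim t by (intro growth_le) (auto simp: field_simps)
      qed (use elim t C V in \<open>auto intro: bounded_linear_V bounded_linear_G V_G\<close>)
      moreover have "(G (t / real n) ^^ n) x = G t x" unfolding G_pow using elim by simp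
      moreover have "V (real n / t) x - G (t / real n) x = (t / real n) *\<^sub>R e n"
      proof -
        have "V (real n / t) x - x = (t / real n) *\<^sub>R V (real n / t) (A x)"
          using elim t by (simp add: V_diff_id[OF _ x]) (simp add: V_def)
        then show ?thesis using elim t by (simp add: e_def algebra_simps)
      qed
      ultimately show ?case using elim t by (simp add: mult_ac)
    qed
    ultimately show "(\<lambda>n. (V (real n / t) ^^ n) x - G t x) \<longlonglongrightarrow> 0"
      by (rule Lim_null_comparison[rotated])
  qed
  then show ?thesis by (simp add: LIM_zero_iff)
qed

lemma exponential_formula:
  assumes "0 < t"
  shows "(\<lambda>n. ((\<lambda>x. (real n / t) *\<^sub>R R (real n / t) x) ^^ n) x) \<longlonglongrightarrow> G t x"
  using tendsto_V_funpow[OF assms, of x] by (simp add: V_def[abs_def])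

end

section \<open>Strongly measurable functions and fibrewise operators\<close>

text \<open>
  On a general measure space diagonal sequences of simple functions are not available.  Instead,
  the limit is approximated by nearest points in a countable set that is dense in its essential range.
\<close>

lemma strongly_measurable_LIMSEQ:
  fixes f :: "nat \<Rightarrow> 'm \<Rightarrow> 'x::real_normed_vector"
  assumes c: "complete_measure \<mu>" and f: "\<And>n. strongly_measurable \<mu> (f n)"
    and lim: "AE m in \<mu>. (\<lambda>n. f n m) \<longlonglongrightarrow> g m"
  shows "strongly_measurable \<mu> g"
proof -
  obtain s where s: "\<And>n i. simple_function \<mu> (s n i)"
    and s_lim: "\<And>n. AE m in \<mu>. (\<lambda>i. s n i m) \<longlonglongrightarrow> f n m"
    using f unfolding strongly_measurable_def by metis
  \<comment> \<open>All values of the approximating simple functions. The point 0 makes the set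
    nonempty even over an empty measure space, so that it can be enumerated.\<close>
  define C where "C = insert 0 (\<Union>n i. s n i ` space \<mu>)"
  have "countable C" unfolding C_def
    by (simp add: countable_finite simple_functionD(1)[OF s])
  moreover have "C \<noteq> {}" by (simp add: C_def)
  ultimately have range_C: "range (from_nat_into C) = C" by (intro range_from_nat_into)
  define e where "e = from_nat_into C"
  define d where "d = (\<lambda>k m. norm (g m - e k))"
  \<comment> \<open>Distances to fixed points are real valued, so measurability passes to the limit;
    completeness absorbs the exceptional null set.\<close>
  have d[measurable]: "d k \<in> borel_measurable \<mu>" for k
  proof -
    have meas: "(\<lambda>m. norm (f n m - e k)) \<in> borel_measurable \<mu>" for n
    proof (rule strongly_measurable_norm[OF c])
      have "AE m in \<mu>. (\<lambda>i. s n i m - e k) \<longlonglongrightarrow> f n m - e k"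
        using s_lim[of n] by eventually_elim (intro tendsto_intros)
      moreover have "simple_function \<mu> (\<lambda>m. s n i m - e k)" for i
        by (rule simple_function_compose1[OF s])
      ultimately show "strongly_measurable \<mu> (\<lambda>m. f n m - e k)"
        unfolding strongly_measurable_def by (intro exI[of _ "\<lambda>i m. s n i m - e k"]) simp
    qed
    have "(\<lambda>m. lim (\<lambda>n. norm (f n m - e k))) \<in> borel_measurable \<mu>"
      by (rule borel_measurable_lim_metric[OF meas])
    moreover have "AE m in \<mu>. lim (\<lambda>n. norm (f n m - e k)) = d k m"
      using lim by eventually_elim (auto simp: d_def intro!: limI tendsto_intros)
    ultimately show ?thesis by (rule borel_measurable_cong_AE_complete[OF c])
  qed
  have dense: "AE m in \<mu>. \<forall>\<epsilon>>0. \<exists>k. d k m < \<epsilon>"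
  proof -
    have "AE m in \<mu>. \<forall>n. (\<lambda>i. s n i m) \<longlonglongrightarrow> f n m" using s_lim by (simp add: AE_all_countable)
    with lim AE_space[of \<mu>] show ?thesis
    proof eventually_elim
      case (elim m)
      show ?case
      proof (intro allI impI)
        fix \<epsilon> :: real assume "0 < \<epsilon>"
        then obtain n where n: "dist (f n m) (g m) < \<epsilon> / 2"
          using tendstoD[OF elim(1), of "\<epsilon> / 2"] by (auto simp: eventually_sequentially)
        obtain i where i: "dist (s n i m) (f n m) < \<epsilon> / 2"
          using tendstoD[OF elim(3)[rule_format], of "\<epsilon> / 2" n] \<open>0 < \<epsilon>\<close> by (auto simp: eventually_sequentially)
        have "s n i m \<in> C" using elim(2) by (auto simp: C_def)
        then obtain k where "e k = s n i m" using range_C unfolding e_def by (metis rangeE)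
        moreover have "dist (g m) (s n i m) < \<epsilon>"
          using n i by (metis dist_commute dist_triangle_half_r)
        ultimately have "d k m < \<epsilon>" by (simp add: d_def dist_norm)
        then show "\<exists>k. d k m < \<epsilon>" ..
      qed
    qed
  qed
  \<comment> \<open>The first index of a nearest point among the initial \<open>i + 1\<close>
    points. Choosing the least minimizer makes the selection measurable, and its finite range makes
    it simple.\<close>
  define K where "K = (\<lambda>i m. LEAST k. k \<le> i \<and> (\<forall>j\<le>i. d k m \<le> d j m))"
  have K: "K i m \<le> i \<and> (\<forall>j\<le>i. d (K i m) m \<le> d j m)" for i m
  proof -
    have "\<exists>k\<in>{..i}. \<forall>j\<in>{..i}. d k m \<le> d j m"
      using arg_min_if_finite[of "{..i}" "\<lambda>j. d j m"] by (metis atMost_iff empty_iff finite_atMost le0 not_le)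
    then obtain k where "k \<le> i \<and> (\<forall>j\<le>i. d k m \<le> d j m)" by auto
    then show ?thesis unfolding K_def by (rule LeastI)
  qed
  have "simple_function \<mu> (\<lambda>m. e (K i m))" for i
  proof (rule simple_function_compose1[of _ "K i" e])
    have "K i \<in> measurable \<mu> (count_space UNIV)" unfolding K_def by measurable
    then have "K i -` {k} \<inter> space \<mu> \<in> sets \<mu>" for k by (rule measurable_sets) simp
    moreover have "finite (K i ` space \<mu>)" using K by (auto intro: finite_subset[of _ "{..i}"])
    ultimately show "simple_function \<mu> (K i)" by (simp add: simple_function_def)
  qed
  moreover have "AE m in \<mu>. (\<lambda>i. e (K i m)) \<longlonglongrightarrow> g m"
    using dense
  proof eventually_elim
    case (elim m)
    show ?case
    proof (rule LIMSEQ_I)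
      fix \<epsilon> :: real assume "0 < \<epsilon>"
      with elim obtain k where k: "d k m < \<epsilon>" by blast
      have "norm (e (K i m) - g m) < \<epsilon>" if "k \<le> i" for i
        using K[of i m] that k by (fastforce simp: d_def norm_minus_commute)
      then show "\<exists>k. \<forall>i\<ge>k. norm (e (K i m) - g m) < \<epsilon>" by blast
    qed
  qed
  ultimately show ?thesis unfolding strongly_measurable_def 
    by (intro exI[of _ "\<lambda>i m. e (K i m)"] conjI allI)
qed

section \<open>Convergence and fibrewise operators in the Bochner space\<close>

lemma bochner_integrable_diff:
  assumes "complete_measure \<mu>" "bochner_integrable \<mu> f" "bochner_integrable \<mu> g"
  shows "bochner_integrable \<mu> (\<lambda>m. f m - g m)"
  using bochner_integrable_add[OF assms(1,2) bochner_integrable_scaleR[OF assms(1,3), of "- 1"]] by simp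

lemma L1_diff:
  assumes c: "complete_measure \<mu>" and u: "bochner_integrable \<mu> u" and v: "bochner_integrable \<mu> v"
  shows "ndiff (L1 \<mu>) (ae_eq \<mu> `` {u}) (ae_eq \<mu> `` {v}) = ae_eq \<mu> `` {\<lambda>m. u m - v m}"
  using L1_add[OF c u bochner_integrable_scaleR[OF c v, of "- 1"]]
  by (simp add: ndiff_def L1_scale[OF c v])

text \<open>Translates convergence of classes into convergence of integrals. Representatives are
  prescribed only eventually along the filter, since the semigroup is controlled only for
  nonnegative times.\<close>

lemma norm_tendsto_L1:
  assumes c: "complete_measure \<mu>" and u: "\<forall>\<^sub>F t in F. bochner_integrable \<mu> (u t) \<and> U t = ae_eq \<mu> `` {u t}"
    and v: "bochner_integrable \<mu> v"
  shows "norm_tendsto (L1 \<mu>) U (ae_eq \<mu> `` {v}) F \<longleftrightarrow> ((\<lambda>t. \<integral>m. norm (u t m - v m) \<partial>\<mu>) \<longlongrightarrow> 0) F"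
  unfolding norm_tendsto_def
proof (rule tendsto_cong)
  show "\<forall>\<^sub>F t in F. nnorm (L1 \<mu>) (ndiff (L1 \<mu>) (U t) (ae_eq \<mu> `` {v})) = (\<integral>m. norm (u t m - v m) \<partial>\<mu>)"
    using u by eventually_elim (simp add: L1_diff[OF c _ v] L1_norm bochner_integrable_diff[OF c _ v])
qed

text \<open>The limit is tested on sequences in (0, 1). The null set excluded in the bound may
  depend on \<open>t\<close>; countably many times contribute only countably many such sets.\<close>

lemma L1_dominated_convergence_at_right:
  assumes c: "complete_measure \<mu>" and u: "\<And>t. 0 < t \<Longrightarrow> t < 1 \<Longrightarrow> bochner_integrable \<mu> (u t)"
    and v: "bochner_integrable \<mu> v" and w: "integrable \<mu> w"
    and lim: "AE m in \<mu>. ((\<lambda>t. u t m) \<longlongrightarrow> v m) (at_right 0)"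
    and bound: "\<And>t. 0 < t \<Longrightarrow> t < 1 \<Longrightarrow> AE m in \<mu>. norm (u t m - v m) \<le> w m"
  shows "((\<lambda>t. \<integral>m. norm (u t m - v m) \<partial>\<mu>) \<longlongrightarrow> 0) (at_right (0::real))"
proof (rule tendsto_at_right_sequentially[of _ 1])
  fix t :: "nat \<Rightarrow> real" assume t: "\<And>n. 0 < t n" "\<And>n. t n < 1" "t \<longlonglongrightarrow> 0"
  have at_right: "filterlim t (at_right 0) sequentially"
    unfolding filterlim_at using t by (auto intro!: always_eventually simp: less_imp_neq[THEN not_sym])
  have "(\<lambda>n. \<integral>m. norm (u (t n) m - v m) \<partial>\<mu>) \<longlonglongrightarrow> (\<integral>m. 0 \<partial>\<mu>)"
  proof (rule integral_dominated_convergence)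
    show "(\<lambda>m. norm (u (t n) m - v m)) \<in> borel_measurable \<mu>" for n
      using bochner_integrable_diff[OF c u[OF t(1,2)] v, of n] by (auto simp: bochner_integrable_def)
    show "AE m in \<mu>. (\<lambda>n. norm (u (t n) m - v m)) \<longlonglongrightarrow> 0"
      using lim
    proof eventually_elim
      case (elim m)
      have "(\<lambda>n. norm (u (t n) m - v m)) \<longlonglongrightarrow> norm (v m - v m)"
        by (intro tendsto_intros filterlim_compose[OF elim at_right])
      then show ?case by simp
    qed
    show "AE m in \<mu>. norm (norm (u (t n) m - v m)) \<le> w m" for n using bound[OF t(1,2)] by simp
  qed (use w in simp_all)
  then show "(\<lambda>n. \<integral>m. norm (u (t n) m - v m) \<partial>\<mu>) \<longlonglongrightarrow> 0" by simp
qed simp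

text \<open>The norm bound common to almost all fibres turns measurability into integrability.
  Fibrewise linearity up to a null set becomes exact linearity on classes.\<close>

lemma
  fixes S :: "'m \<Rightarrow> 'x::real_normed_vector \<Rightarrow> 'x"
  assumes c: "complete_measure \<mu>"
    and S: "AE m in \<mu>. bounded_linear (S m) \<and> (\<forall>x. norm (S m x) \<le> K * norm x)"
    and meas: "\<And>f. bochner_integrable \<mu> f \<Longrightarrow> strongly_measurable \<mu> (\<lambda>m. S m (f m))"
  shows bochner_integrable_fibre: "bochner_integrable \<mu> f \<Longrightarrow> bochner_integrable \<mu> (\<lambda>m. S m (f m))"
    and bounded_operator_fibre_op: "bounded_operator (L1 \<mu>) (fibre_op \<mu> S)"
proof -
  have int: "bochner_integrable \<mu> (\<lambda>m. S m (f m))" if "bochner_integrable \<mu> f" for f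
  proof (rule bochner_integrable_bound[OF c meas[OF that]])
    show "integrable \<mu> (\<lambda>m. K * norm (f m))" using that by (simp add: bochner_integrable_def)
    show "AE m in \<mu>. norm (S m (f m)) \<le> K * norm (f m)" using S by eventually_elim blast
  qed
  then show "bochner_integrable \<mu> f \<Longrightarrow> bochner_integrable \<mu> (\<lambda>m. S m (f m))" .
  have op: "fibre_op \<mu> S (ae_eq \<mu> `` {f}) = ae_eq \<mu> `` {\<lambda>m. S m (f m)}"
    if "bochner_integrable \<mu> f" for f
    using that by (intro fibre_op_class c int)
  show "bounded_operator (L1 \<mu>) (fibre_op \<mu> S)"
    unfolding bounded_operator_def
  proof (intro conjI ballI allI exI[of _ K])
    fix U :: "('m \<Rightarrow> 'x) set" assume "U \<in> nspace (L1 \<mu>)"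
    then obtain u where u: "bochner_integrable \<mu> u" "U = ae_eq \<mu> `` {u}" by (rule L1_cases)
    show "fibre_op \<mu> S U \<in> nspace (L1 \<mu>)" by (simp add: u op ae_class_in_L1 int)
    show "fibre_op \<mu> S (nscale (L1 \<mu>) a U) = nscale (L1 \<mu>) a (fibre_op \<mu> S U)" for a
    proof -
      have "AE m in \<mu>. S m (a *\<^sub>R u m) = a *\<^sub>R S m (u m)"
        using S by eventually_elim (auto dest: bounded_linear.linear linear_scale)
      then show ?thesis
        by (simp add: u op L1_scale[OF c] int bochner_integrable_scaleR[OF c] ae_class_eq_iff)
    qed
    have "(\<integral>m. norm (S m (u m)) \<partial>\<mu>) \<le> (\<integral>m. K * norm (u m) \<partial>\<mu>)"
    proof (rule integral_mono_AE)
      show "AE m in \<mu>. norm (S m (u m)) \<le> K * norm (u m)" using S by eventually_elim blast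
    qed (use int[OF u(1)] u(1) in \<open>simp_all add: bochner_integrable_def\<close>)
    then show "nnorm (L1 \<mu>) (fibre_op \<mu> S U) \<le> K * nnorm (L1 \<mu>) U"
      using u(1) by (simp add: u op L1_norm int)
    fix W :: "('m \<Rightarrow> 'x) set" assume "W \<in> nspace (L1 \<mu>)"
    then obtain w where w: "bochner_integrable \<mu> w" "W = ae_eq \<mu> `` {w}" by (rule L1_cases)
    have "AE m in \<mu>. S m (u m + w m) = S m (u m) + S m (w m)"
      using S by eventually_elim (auto dest: bounded_linear.linear linear_add)
    then show "fibre_op \<mu> S (nadd (L1 \<mu>) U W) = nadd (L1 \<mu>) (fibre_op \<mu> S U) (fibre_op \<mu> S W)"
      by (simp add: u w op L1_add[OF c] int bochner_integrable_add[OF c] ae_class_eq_iff)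
  qed
qed

lemma
  assumes c: "complete_measure \<mu>" and U: "U \<in> nspace (L1 \<mu>)"
  shows L1_scale_closed: "nscale (L1 \<mu>) a U \<in> nspace (L1 \<mu>)"
    and L1_add_closed: "W \<in> nspace (L1 \<mu>) \<Longrightarrow> nadd (L1 \<mu>) U W \<in> nspace (L1 \<mu>)"
proof -
  obtain u where u: "bochner_integrable \<mu> u" "U = ae_eq \<mu> `` {u}" using U by (rule L1_cases)
  show "nscale (L1 \<mu>) a U \<in> nspace (L1 \<mu>)"
    by (simp add: u L1_scale[OF c] ae_class_in_L1 bochner_integrable_scaleR[OF c])
  assume "W \<in> nspace (L1 \<mu>)"
  then obtain w where w: "bochner_integrable \<mu> w" "W = ae_eq \<mu> `` {w}" by (rule L1_cases)
  show "nadd (L1 \<mu>) U W \<in> nspace (L1 \<mu>)"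
    by (simp add: u w L1_add[OF c] ae_class_in_L1 bochner_integrable_add[OF c])
qed

text \<open>Serves to transfer boundedness to the resolvent, which as an inverse function is
  determined only on the carrier.\<close>

lemma bounded_operator_L1_cong:
  assumes c: "complete_measure \<mu>" and eq: "\<And>U. U \<in> nspace (L1 \<mu>) \<Longrightarrow> B U = B' U"
    and B': "bounded_operator (L1 \<mu>) B'"
  shows "bounded_operator (L1 \<mu>) B"
  using B' unfolding bounded_operator_def by (simp add: eq L1_scale_closed[OF c] L1_add_closed[OF c])

section \<open>The fibrewise semigroup\<close>

locale fibre_semigroup =
  fixes \<mu> :: "'m measure" and D :: "'m \<Rightarrow> ('x::banach) set" and T :: "'m \<Rightarrow> 'x \<Rightarrow> 'x"
    and G :: "'m \<Rightarrow> real \<Rightarrow> 'x \<Rightarrow> 'x" and M \<omega> :: real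
  assumes complete: "complete_measure \<mu>"
    and semigroup: "AE m in \<mu>. exp_bounded_semigroup (D m) (T m) (G m) M \<omega>"
    and resolvent_measurable: "\<And>l f. l > \<omega> \<Longrightarrow> bochner_integrable \<mu> f \<Longrightarrow>
      strongly_measurable \<mu> (\<lambda>m. resolvent type_space (D m) (T m) l (f m))"
begin

abbreviation res where "res m \<equiv> resolvent type_space (D m) (T m)"

lemma R_bounded:
  "\<omega> < l \<Longrightarrow> AE m in \<mu>. bounded_linear (res m l) \<and> (\<forall>x. norm (res m l x) \<le> M / (l - \<omega>) * norm x)"
  using semigroup
  by eventually_elim (simp only: exp_bounded_semigroup.bounded_linear_R exp_bounded_semigroup.norm_R_le simp_thms)

lemma bochner_integrable_R:
  "\<omega> < l \<Longrightarrow> bochner_integrable \<mu> f \<Longrightarrow> bochner_integrable \<mu> (\<lambda>m. res m l (f m))"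
  by (rule bochner_integrable_fibre[OF complete R_bounded resolvent_measurable])

lemma bochner_integrable_R_funpow:
  assumes l: "\<omega> < l" and f: "bochner_integrable \<mu> f"
  shows "bochner_integrable \<mu> (\<lambda>m. ((\<lambda>x. a *\<^sub>R res m l x) ^^ n) (f m))"
proof (induction n)
  case (Suc n)
  then show ?case by (simp add: bochner_integrable_scaleR[OF complete] bochner_integrable_R[OF l])
qed (use f in simp)

lemma G_measurable:
  assumes t: "0 \<le> t" and f: "bochner_integrable \<mu> f"
  shows "strongly_measurable \<mu> (\<lambda>m. G m t (f m))"
proof (cases "t = 0")
  case True
  show ?thesis
  proof (rule strongly_measurable_cong_AE)
    show "strongly_measurable \<mu> f" using f by (simp add: bochner_integrable_def)
    show "AE m in \<mu>. f m = G m t (f m)"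
      using semigroup by eventually_elim (simp add: True exp_bounded_semigroup.G_0)
  qed
next
  case False
  \<comment> \<open>The resolvent hypothesis covers n/t only beyond \<open>\<omega>\<close>, so the
    sequence of the exponential formula is started at index \<open>N\<close>.\<close>
  obtain N :: nat where N: "\<omega> * t < real N" using reals_Archimedean2 by blast
  have l: "\<omega> < real (n + N) / t" for n using N t False by (simp add: pos_less_divide_eq)
  show ?thesis
  proof (rule strongly_measurable_LIMSEQ[OF complete])
    show "strongly_measurable \<mu> (\<lambda>m. ((\<lambda>x. (real (n + N) / t) *\<^sub>R res m (real (n + N) / t) x) ^^ (n + N)) (f m))" for n
      using bochner_integrable_R_funpow[OF l f] unfolding bochner_integrable_def by blast
    show "AE m in \<mu>. (\<lambda>n. ((\<lambda>x. (real (n + N) / t) *\<^sub>R res m (real (n + N) / t) x) ^^ (n + N)) (f m)) \<longlonglongrightarrow> G m t (f m)"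
      using semigroup
    proof eventually_elim
      case (elim m)
      then interpret exp_bounded_semigroup "D m" "T m" "G m" M \<omega> .
      show ?case using LIMSEQ_ignore_initial_segment[OF exponential_formula[of t "f m"], of N] t False by simp
    qed
  qed
qed

lemma G_bounded:
  assumes "0 \<le> t" "t \<le> \<tau>"
  shows "AE m in \<mu>. bounded_linear (G m t) \<and> (\<forall>x. norm (G m t x) \<le> M * exp (\<bar>\<omega>\<bar> * \<tau>) * norm x)"
  using semigroup
  by eventually_elim
    (simp only: exp_bounded_semigroup.bounded_linear_G exp_bounded_semigroup.growth_le assms simp_thms)

lemma bochner_integrable_G:
  "0 \<le> t \<Longrightarrow> bochner_integrable \<mu> f \<Longrightarrow> bochner_integrable \<mu> (\<lambda>m. G m t (f m))"
  by (rule bochner_integrable_fibre[OF complete G_bounded[OF _ order_refl] G_measurable])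

definition GG :: "real \<Rightarrow> ('m \<Rightarrow> 'x) set \<Rightarrow> ('m \<Rightarrow> 'x) set" where
  "GG t = fibre_op \<mu> (\<lambda>m. G m t)"

lemma GG_class:
  "0 \<le> t \<Longrightarrow> bochner_integrable \<mu> u \<Longrightarrow> GG t (ae_eq \<mu> `` {u}) = ae_eq \<mu> `` {\<lambda>m. G m t (u m)}"
  unfolding GG_def by (intro fibre_op_class complete bochner_integrable_G)

lemma C0_semigroup_GG: "C0_semigroup (L1 \<mu>) GG"
  unfolding C0_semigroup_def
proof (intro conjI allI impI ballI)
  fix t :: real assume "0 \<le> t"
  then show "bounded_operator (L1 \<mu>) (GG t)"
    unfolding GG_def by (intro bounded_operator_fibre_op[OF complete G_bounded[OF _ order_refl] G_measurable])
next
  fix U :: "('m \<Rightarrow> 'x) set" assume "U \<in> nspace (L1 \<mu>)"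
  then obtain u where u: "bochner_integrable \<mu> u" "U = ae_eq \<mu> `` {u}" by (rule L1_cases)
  have "AE m in \<mu>. G m 0 (u m) = u m"
    using semigroup by eventually_elim (rule exp_bounded_semigroup.G_0)
  then show "GG 0 U = U" by (simp add: u GG_class ae_class_eq_iff bochner_integrable_G)
  show "norm_tendsto (L1 \<mu>) (\<lambda>t. GG t U) U (at_right 0)"
    unfolding u(2)
  proof (subst norm_tendsto_L1[OF complete _ u(1)])
    show "\<forall>\<^sub>F t in at_right 0. bochner_integrable \<mu> (\<lambda>m. G m t (u m)) \<and>
        GG t (ae_eq \<mu> `` {u}) = ae_eq \<mu> `` {\<lambda>m. G m t (u m)}"
      using eventually_at_right_less by eventually_elim (simp add: u GG_class bochner_integrable_G)
    show "((\<lambda>t. \<integral>m. norm (G m t (u m) - u m) \<partial>\<mu>) \<longlongrightarrow> 0) (at_right 0)"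
    proof (rule L1_dominated_convergence_at_right[OF complete _ u(1)])
      \<comment> \<open>The growth bound on the unit time interval gives a majorant independent of
        \<open>t\<close>.\<close>
      show "integrable \<mu> (\<lambda>m. M * exp (\<bar>\<omega>\<bar> * 1) * norm (u m) + norm (u m))"
        using u(1) by (simp add: bochner_integrable_def)
      show "AE m in \<mu>. ((\<lambda>t. G m t (u m)) \<longlongrightarrow> u m) (at_right 0)"
        using semigroup by eventually_elim (rule exp_bounded_semigroup.tendsto_G_0)
      fix t :: real assume t: "0 < t" "t < 1"
      then show "bochner_integrable \<mu> (\<lambda>m. G m t (u m))" by (simp add: u bochner_integrable_G)
      have "AE m in \<mu>. norm (G m t (u m)) \<le> M * exp (\<bar>\<omega>\<bar> * 1) * norm (u m)"
        using G_bounded[of t 1] t by auto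
      then show "AE m in \<mu>. norm (G m t (u m) - u m) \<le> M * exp (\<bar>\<omega>\<bar> * 1) * norm (u m) + norm (u m)"
        by eventually_elim (metis add_right_mono norm_triangle_ineq4 order_trans)
    qed
  qed
  fix s t :: real assume st: "0 \<le> s" "0 \<le> t"
  have "AE m in \<mu>. G m (s + t) (u m) = G m s (G m t (u m))"
    using semigroup by eventually_elim (simp add: exp_bounded_semigroup.G_add st)
  then show "GG (s + t) U = GG s (GG t U)"
    using st by (simp add: u GG_class ae_class_eq_iff bochner_integrable_G)
qed

section \<open>Identification of the generator on the Bochner space\<close>

lemma right_derivative_GG_iff:
  assumes u: "bochner_integrable \<mu> u" and v: "bochner_integrable \<mu> v"
  shows "has_right_derivative_at_0 (L1 \<mu>) GG (ae_eq \<mu> `` {u}) (ae_eq \<mu> `` {v}) \<longleftrightarrow>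
    ((\<lambda>h. \<integral>m. norm ((1 / h) *\<^sub>R (G m h (u m) - u m) - v m) \<partial>\<mu>) \<longlongrightarrow> 0) (at_right 0)"
  unfolding has_right_derivative_at_0_def
proof (rule norm_tendsto_L1[OF complete _ v])
  show "\<forall>\<^sub>F h in at_right 0. bochner_integrable \<mu> (\<lambda>m. (1 / h) *\<^sub>R (G m h (u m) - u m)) \<and>
      nscale (L1 \<mu>) (1 / h) (ndiff (L1 \<mu>) (GG h (ae_eq \<mu> `` {u})) (ae_eq \<mu> `` {u})) =
      ae_eq \<mu> `` {\<lambda>m. (1 / h) *\<^sub>R (G m h (u m) - u m)}"
    using eventually_at_right_less
  proof eventually_elim
    case (elim h)
    then have "bochner_integrable \<mu> (\<lambda>m. G m h (u m) - u m)"
      by (intro bochner_integrable_diff complete bochner_integrable_G u) simp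
    with elim show ?case
      by (simp only: GG_class[OF less_imp_le u] L1_diff[OF complete bochner_integrable_G[OF less_imp_le u] u]
        L1_scale[OF complete] bochner_integrable_scaleR[OF complete] simp_thms)
  qed
qed

text \<open>One inclusion: for \<open>u\<close> in the fibrewise domain,
  \<open>norm_G_diff_id_le\<close> dominates all difference quotients by a fixed multiple of the
  norm of \<open>T m (u m)\<close>.\<close>

lemma right_derivative_GG:
  assumes u: "bochner_integrable \<mu> u" "AE m in \<mu>. u m \<in> D m"
    and v: "bochner_integrable \<mu> (\<lambda>m. T m (u m))"
  shows "has_right_derivative_at_0 (L1 \<mu>) GG (ae_eq \<mu> `` {u}) (ae_eq \<mu> `` {\<lambda>m. T m (u m)})"
  unfolding right_derivative_GG_iff[OF u(1) v]
proof (rule L1_dominated_convergence_at_right[OF complete _ v])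
  show "integrable \<mu> (\<lambda>m. M * exp \<bar>\<omega>\<bar> * norm (T m (u m)) + norm (T m (u m)))"
    using v by (simp add: bochner_integrable_def)
  show "AE m in \<mu>. ((\<lambda>h. (1 / h) *\<^sub>R (G m h (u m) - u m)) \<longlongrightarrow> T m (u m)) (at_right 0)"
    using semigroup u(2) by eventually_elim (rule exp_bounded_semigroup.generator_tendsto)
  fix h :: real assume h: "0 < h" "h < 1"
  then show "bochner_integrable \<mu> (\<lambda>m. (1 / h) *\<^sub>R (G m h (u m) - u m))"
    by (intro bochner_integrable_scaleR bochner_integrable_diff complete bochner_integrable_G u) simp
  show "AE m in \<mu>. norm ((1 / h) *\<^sub>R (G m h (u m) - u m) - T m (u m)) \<le>
      M * exp \<bar>\<omega>\<bar> * norm (T m (u m)) + norm (T m (u m))"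
    using semigroup u(2)
  proof eventually_elim
    case (elim m)
    have "norm (G m h (u m) - u m) \<le> h * (M * exp \<bar>\<omega>\<bar> * norm (T m (u m)))"
      using h by (intro exp_bounded_semigroup.norm_G_diff_id_le[OF elim]) auto
    then have "norm ((1 / h) *\<^sub>R (G m h (u m) - u m)) \<le> M * exp \<bar>\<omega>\<bar> * norm (T m (u m))"
      using h by (simp add: pos_divide_le_eq mult.commute)
    then show ?case by (metis add_right_mono norm_triangle_ineq4 order_trans)
  qed
qed

text \<open>The other inclusion. Convergence in the mean gives pointwise convergence only along a
  subsequence, which is why the generator of a fibre has to be recognised from one sequence of
  times.\<close>

lemma right_derivative_GG_D:
  assumes u: "bochner_integrable \<mu> u" and v: "bochner_integrable \<mu> v"
    and deriv: "has_right_derivative_at_0 (L1 \<mu>) GG (ae_eq \<mu> `` {u}) (ae_eq \<mu> `` {v})"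
  shows "AE m in \<mu>. u m \<in> D m \<and> T m (u m) = v m"
proof -
  define h where "h = (\<lambda>n. 1 / real (Suc n))"
  have h_pos: "0 < h n" for n by (simp add: h_def)
  have h: "filterlim h (at_right 0) sequentially"
    unfolding filterlim_at h_def using LIMSEQ_Suc[OF lim_1_over_n] by (auto intro!: always_eventually)
  define e where "e = (\<lambda>n m. norm ((1 / h n) *\<^sub>R (G m (h n) (u m) - u m) - v m))"
  have "integrable \<mu> (e n)" for n
  proof -
    have "bochner_integrable \<mu> (\<lambda>m. (1 / h n) *\<^sub>R (G m (h n) (u m) - u m) - v m)"
      using h_pos[of n]
      by (intro bochner_integrable_diff bochner_integrable_scaleR complete bochner_integrable_G u v) simp
    then show ?thesis by (simp add: bochner_integrable_def e_def)
  qed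
  moreover have "(\<lambda>n. \<integral>m. norm (e n m) \<partial>\<mu>) \<longlonglongrightarrow> 0"
    using filterlim_compose[OF deriv[unfolded right_derivative_GG_iff[OF u v]] h] by (simp add: e_def)
  ultimately obtain r :: "nat \<Rightarrow> nat" where r: "strict_mono r" "AE m in \<mu>. (\<lambda>n. e (r n) m) \<longlonglongrightarrow> 0"
    using tendsto_L1_AE_subseq[of \<mu> e] by blast
  from semigroup r(2) show ?thesis
  proof eventually_elim
    case (elim m)
    then have lim: "(\<lambda>n. (1 / h (r n)) *\<^sub>R (G m (h (r n)) (u m) - u m)) \<longlonglongrightarrow> v m"
      unfolding e_def tendsto_norm_zero_iff LIM_zero_iff by blast
    have hr: "filterlim (\<lambda>n. h (r n)) (at_right 0) sequentially"
      by (rule filterlim_compose[OF h filterlim_subseq[OF r(1)]])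
    show ?case using exp_bounded_semigroup.generatorI_sequentially[OF elim(1) hr lim] by blast
  qed
qed

lemma generates_GG: "generates (L1 \<mu>) (fibre_domain \<mu> D T) (fibre_op \<mu> T) GG"
  unfolding generates_def
proof (intro conjI C0_semigroup_GG ballI set_eqI)
  fix U assume U: "U \<in> fibre_domain \<mu> D T"
  then have "U \<in> nspace (L1 \<mu>)" by (simp add: fibre_domain_def)
  then obtain u where u: "bochner_integrable \<mu> u" "U = ae_eq \<mu> `` {u}" by (rule L1_cases)
  with U have Tu: "AE m in \<mu>. u m \<in> D m" "bochner_integrable \<mu> (\<lambda>m. T m (u m))"
    by (auto simp: fibre_domain_iff[OF complete])
  show "fibre_op \<mu> T U \<in> nspace (L1 \<mu>)" "has_right_derivative_at_0 (L1 \<mu>) GG U (fibre_op \<mu> T U)"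
    using right_derivative_GG[OF u(1) Tu]
    by (simp_all add: u fibre_op_class[where T = T, OF complete u(1) Tu(2)] ae_class_in_L1 Tu(2))
next
  fix U
  show "U \<in> fibre_domain \<mu> D T \<longleftrightarrow>
      U \<in> {x \<in> nspace (L1 \<mu>). \<exists>y\<in>nspace (L1 \<mu>). has_right_derivative_at_0 (L1 \<mu>) GG x y}"
  proof (cases "U \<in> nspace (L1 \<mu>)")
    case True
    then obtain u where u: "bochner_integrable \<mu> u" "U = ae_eq \<mu> `` {u}" by (rule L1_cases)
    have "(\<exists>W\<in>nspace (L1 \<mu>). has_right_derivative_at_0 (L1 \<mu>) GG U W) \<longleftrightarrow>
        (AE m in \<mu>. u m \<in> D m) \<and> bochner_integrable \<mu> (\<lambda>m. T m (u m))"
    proof (intro iffI conjI)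
      assume "\<exists>W\<in>nspace (L1 \<mu>). has_right_derivative_at_0 (L1 \<mu>) GG U W"
      then obtain v where v: "bochner_integrable \<mu> v"
        and "has_right_derivative_at_0 (L1 \<mu>) GG U (ae_eq \<mu> `` {v})"
        by (metis L1_cases)
      then have ae: "AE m in \<mu>. u m \<in> D m \<and> T m (u m) = v m"
        using right_derivative_GG_D[OF u(1) v] by (simp add: u)
      then show "AE m in \<mu>. u m \<in> D m" by eventually_elim simp
      from ae have "AE m in \<mu>. v m = T m (u m)" by eventually_elim simp
      then show "bochner_integrable \<mu> (\<lambda>m. T m (u m))" by (rule bochner_integrable_cong_AE[OF complete v])
    next
      assume "(AE m in \<mu>. u m \<in> D m) \<and> bochner_integrable \<mu> (\<lambda>m. T m (u m))"
      then show "\<exists>W\<in>nspace (L1 \<mu>). has_right_derivative_at_0 (L1 \<mu>) GG U W"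
        using right_derivative_GG[OF u(1)] ae_class_in_L1 u(2) by blast
    qed
    then show ?thesis using True by (simp add: u fibre_domain_iff[OF complete])
  qed (simp add: fibre_domain_def)
qed

text \<open>The fibrewise resolvent \<open>RR\<close> is checked to be a two-sided inverse of l - T
  on classes; uniqueness of inverses then identifies it with the resolvent on the carrier.\<close>

lemma
  assumes l: "\<omega> < l"
  shows mem_resolvent_set: "l \<in> resolvent_set (L1 \<mu>) (fibre_domain \<mu> D T) (fibre_op \<mu> T)"
    and resolvent_L1: "U \<in> nspace (L1 \<mu>) \<Longrightarrow>
      resolvent (L1 \<mu>) (fibre_domain \<mu> D T) (fibre_op \<mu> T) l U = fibre_op \<mu> (\<lambda>m. res m l) U"
proof -
  define B where "B = (\<lambda>U. ndiff (L1 \<mu>) (nscale (L1 \<mu>) l U) (fibre_op \<mu> T U))"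
  define RR where "RR = fibre_op \<mu> (\<lambda>m. res m l)"
  have RR: "RR (ae_eq \<mu> `` {f}) = ae_eq \<mu> `` {\<lambda>m. res m l (f m)}" if "bochner_integrable \<mu> f" for f
    unfolding RR_def using that by (intro fibre_op_class complete bochner_integrable_R l)
  have B: "B (ae_eq \<mu> `` {u}) = ae_eq \<mu> `` {\<lambda>m. l *\<^sub>R u m - T m (u m)}"
    if "bochner_integrable \<mu> u" "bochner_integrable \<mu> (\<lambda>m. T m (u m))" for u
    using that unfolding B_def
    by (simp add: fibre_op_class[OF complete] L1_scale[OF complete] L1_diff[OF complete]
      bochner_integrable_scaleR[OF complete])
  have right: "RR U \<in> fibre_domain \<mu> D T \<and> B (RR U) = U" if U: "U \<in> nspace (L1 \<mu>)" for U
  proof -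
    obtain f where f: "bochner_integrable \<mu> f" "U = ae_eq \<mu> `` {f}" using U by (rule L1_cases)
    note Rf = bochner_integrable_R[OF l f(1)]
    \<comment> \<open>The identity T R f = l R f - f gives integrability of T R f, although no
      measurability is assumed for the family \<open>T\<close> itself.\<close>
    have "AE m in \<mu>. l *\<^sub>R res m l (f m) - f m = T m (res m l (f m))"
      using semigroup by eventually_elim (simp add: exp_bounded_semigroup.A_R l)
    then have TR: "bochner_integrable \<mu> (\<lambda>m. T m (res m l (f m)))"
      by (rule bochner_integrable_cong_AE[OF complete bochner_integrable_diff[OF complete
        bochner_integrable_scaleR[OF complete Rf] f(1)]])
    have "AE m in \<mu>. res m l (f m) \<in> D m"
      using semigroup by eventually_elim (rule exp_bounded_semigroup.R_in_D[OF _ l])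
    then have "RR U \<in> fibre_domain \<mu> D T" by (simp add: f RR fibre_domain_iff[OF complete Rf] TR)
    moreover have "AE m in \<mu>. l *\<^sub>R res m l (f m) - T m (res m l (f m)) = f m"
      using semigroup by eventually_elim (simp add: exp_bounded_semigroup.A_R l)
    then have "B (RR U) = U"
      by (simp add: f RR B[OF Rf TR] ae_class_eq_iff bochner_integrable_diff[OF complete]
        bochner_integrable_scaleR[OF complete] Rf TR)
    ultimately show ?thesis ..
  qed
  have left: "B U \<in> nspace (L1 \<mu>) \<and> RR (B U) = U" if U: "U \<in> fibre_domain \<mu> D T" for U
  proof -
    from U have "U \<in> nspace (L1 \<mu>)" by (simp add: fibre_domain_def)
    then obtain u where u: "bochner_integrable \<mu> u" "U = ae_eq \<mu> `` {u}" by (rule L1_cases)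
    with U have Tu: "AE m in \<mu>. u m \<in> D m" "bochner_integrable \<mu> (\<lambda>m. T m (u m))"
      by (auto simp: fibre_domain_iff[OF complete])
    have Bu: "bochner_integrable \<mu> (\<lambda>m. l *\<^sub>R u m - T m (u m))"
      by (intro bochner_integrable_diff bochner_integrable_scaleR complete u Tu)
    have "AE m in \<mu>. res m l (l *\<^sub>R u m - T m (u m)) = u m"
      using semigroup Tu(1) by eventually_elim (rule exp_bounded_semigroup.R_eqI[OF _ l _ refl])
    then show ?thesis
      by (simp add: u B[OF u(1) Tu(2)] RR[OF Bu] ae_class_in_L1[OF Bu] ae_class_eq_iff
        bochner_integrable_R[OF l Bu])
  qed
  have bij: "bij_betw B (fibre_domain \<mu> D T) (nspace (L1 \<mu>))"
    by (rule bij_betw_byWitness[of _ RR]) (use left right in auto)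
  have resolvent_eq: "resolvent (L1 \<mu>) (fibre_domain \<mu> D T) (fibre_op \<mu> T) l U = RR U" if "U \<in> nspace (L1 \<mu>)" for U
    unfolding resolvent_def B_def[symmetric]
    using bij right[OF that] by (intro inv_into_f_eq) (auto simp: bij_betw_def)
  then show "U \<in> nspace (L1 \<mu>) \<Longrightarrow>
      resolvent (L1 \<mu>) (fibre_domain \<mu> D T) (fibre_op \<mu> T) l U = fibre_op \<mu> (\<lambda>m. res m l) U"
    by (simp add: RR_def)
  have "bounded_operator (L1 \<mu>) RR"
    unfolding RR_def by (rule bounded_operator_fibre_op[OF complete R_bounded[OF l] resolvent_measurable[OF l]])
  then show "l \<in> resolvent_set (L1 \<mu>) (fibre_domain \<mu> D T) (fibre_op \<mu> T)"
    using bij bounded_operator_L1_cong[OF complete resolvent_eq] unfolding resolvent_set_def B_def by simp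
qed

end

text \<open>Passes from the chosen representatives to arbitrary ones of both classes, the form in
  which pointwise formulas on classes are stated.\<close>

lemma AE_fibre_op:
  assumes c: "complete_measure \<mu>" and U: "U \<in> nspace (L1 \<mu>)"
    and S: "\<And>f. bochner_integrable \<mu> f \<Longrightarrow> bochner_integrable \<mu> (\<lambda>m. S m (f m))"
    and uv: "u \<in> U" "v \<in> fibre_op \<mu> S U"
  shows "AE m in \<mu>. v m = S m (u m)"
proof -
  obtain w where w: "bochner_integrable \<mu> w" "U = ae_eq \<mu> `` {w}" using U by (rule L1_cases)
  have "v \<in> ae_eq \<mu> `` {\<lambda>m. S m (w m)}"
    using uv(2) unfolding w(2) fibre_op_class[where T = S, OF c w(1) S[OF w(1)]] .
  with uv(1) have "AE m in \<mu>. w m = u m" "AE m in \<mu>. S m (w m) = v m"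
    by (simp_all add: w(2) ae_eq_def)
  then show ?thesis by eventually_elim simp
qed

theorem proposition2p1:
  fixes \<mu> :: "'m measure"
    and D :: "'m \<Rightarrow> ('x::banach) set"
    and T :: "'m \<Rightarrow> 'x \<Rightarrow> 'x"
    and G :: "'m \<Rightarrow> real \<Rightarrow> 'x \<Rightarrow> 'x"
    and M\<^sub>m \<omega>\<^sub>m :: "'m \<Rightarrow> real"
    and M \<omega> :: real
  assumes "complete_measure \<mu>"
    and "AE m in \<mu>. generates type_space (D m) (T m) (G m) \<and>
           M\<^sub>m m \<ge> 1 \<and> (\<forall>t\<ge>0. onorm (G m t) \<le> M\<^sub>m m * exp (\<omega>\<^sub>m m * t)) \<and>
           M\<^sub>m m \<le> M \<and> \<omega>\<^sub>m m \<le> \<omega>"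
    and "\<And>l f. l > \<omega> \<Longrightarrow> bochner_integrable \<mu> f \<Longrightarrow>
           strongly_measurable \<mu> (\<lambda>m. resolvent type_space (D m) (T m) l (f m))"
  shows "\<exists>GG. generates (L1 \<mu>) (fibre_domain \<mu> D T) (fibre_op \<mu> T) GG \<and>
           (\<forall>U\<in>nspace (L1 \<mu>). \<forall>t\<ge>0. \<forall>u\<in>U. \<forall>v\<in>GG t U. AE m in \<mu>. v m = G m t (u m)) \<and>
           (\<forall>l>\<omega>. l \<in> resolvent_set (L1 \<mu>) (fibre_domain \<mu> D T) (fibre_op \<mu> T) \<and>
              (\<forall>F\<in>nspace (L1 \<mu>). \<forall>f\<in>F.
                 \<forall>v\<in>resolvent (L1 \<mu>) (fibre_domain \<mu> D T) (fibre_op \<mu> T) l F.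
                   AE m in \<mu>. v m = resolvent type_space (D m) (T m) l (f m)))"
proof -
  have semigroup: "AE m in \<mu>. exp_bounded_semigroup (D m) (T m) (G m) M \<omega>"
    using assms(2)
  proof eventually_elim
    case (elim m)
    show ?case
    proof
      show "generates type_space (D m) (T m) (G m)" "1 \<le> M" using elim by auto
      fix t :: real and x assume t: "0 \<le> t"
      \<comment> \<open>Boundedness comes from the semigroup property and makes \<open>onorm\<close>
        an actual bound for the values.\<close>
      have "bounded_linear (G m t)" using elim t by (auto simp: generates_def C0_semigroup_def)
      then have "norm (G m t x) \<le> onorm (G m t) * norm x" by (rule onorm)
      also have "\<dots> \<le> M * exp (\<omega> * t) * norm x"
      proof (rule mult_right_mono)
        have "onorm (G m t) \<le> M\<^sub>m m * exp (\<omega>\<^sub>m m * t)" using elim t by blast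
        also have "\<dots> \<le> M * exp (\<omega> * t)"
          using elim t by (intro mult_mono) (auto intro: mult_right_mono)
        finally show "onorm (G m t) \<le> M * exp (\<omega> * t)" .
      qed simp
      finally show "norm (G m t x) \<le> M * exp (\<omega> * t) * norm x" .
    qed
  qed
  interpret fibre_semigroup \<mu> D T G M \<omega> by (intro fibre_semigroup.intro assms(1) semigroup assms(3))
  show ?thesis
  proof (intro exI[of _ GG] conjI generates_GG ballI allI impI)
    fix U t u v assume "U \<in> nspace (L1 \<mu>)" "0 \<le> t" "u \<in> U" "v \<in> GG t U"
    then show "AE m in \<mu>. v m = G m t (u m)"
      unfolding GG_def by (intro AE_fibre_op[OF complete _ bochner_integrable_G])
  next
    fix l assume l: "\<omega> < l"
    then show "l \<in> resolvent_set (L1 \<mu>) (fibre_domain \<mu> D T) (fibre_op \<mu> T)" by (rule mem_resolvent_set)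
    fix F f v assume "F \<in> nspace (L1 \<mu>)" "f \<in> F"
      "v \<in> resolvent (L1 \<mu>) (fibre_domain \<mu> D T) (fibre_op \<mu> T) l F"
    then show "AE m in \<mu>. v m = res m l (f m)"
      using l by (intro AE_fibre_op[OF complete _ bochner_integrable_R]) (simp_all add: resolvent_L1)
  qed
qed

end
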